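(* For each $n\ge 1$ consider $n+2$ independent continuous time random walks $X_1(t),\dots,X_{n+2}(t)$ which begin at the integer locations $x_1<x_2<\cdots<x_{n+2}$ at time $t=0$. For given integers $y_1<y_2<\dots<y_{n+2}$ and $T>0$, let $\mathbb{P}_{n+2}(x_1,\dots,x_{n+2};y_1,\dots,y_{n+2};T)$ be the probability that $X_j(T)=y_j$ for $j=1,\dots,n+2$ and that $X_1(t),\dots,X_{n+2}(t)$ do not intersect for $0\le t\le T$. Assume $x_j=j$ for $1\le j\le n+2$, $y_k=k$ for $1\le k\le n$, while $y_{n+1}$ and $y_{n+2}$ are arbitrary except for the restriction $n<y_{n+1}<y_{n+2}$. If $T$, $\beta_1:=y_{n+1}-n$ and $\beta_2:=y_{n+2}-n$ are bounded as $n\to\infty$, then as $n\to\infty$ $$\mathbb{P}_{n+2}(x_1,\dots,x_{n+2};y_1,\dots,y_{n+2};T)=\frac{e^{-(n+2)T}\left(\frac{T}{2}\right)^{\beta_1+\beta_2-3}e^{\frac{T^2}{4}}}{(\beta_1-1)!\,(\beta_2-1)!}\,(\beta_2-\beta_1)\left(1+O\left(\frac{1}{n^2}\right)\right).$$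
   Context: A continuous time random walk started at $x\in\mathbb{Z}$ is the process $X(t)=x+N_1(t)-N_2(t)$, $t\ge 0$, where $N_1,N_2$ are independent Poisson processes of rate $\lambda=1/2$. The walks do not intersect for $0\le t\le T$ if $X_i(t)\neq X_j(t)$ for all $i\ne j$ and all $t\in[0,T]$. *)

theory Defs
  imports "HOL-Probability.Probability" "HOL-Library.Landau_Symbols"
begin

(* A process Z, indexed by times t \<ge> 0, as a single random element of the product space
   over [0, \<infinity>); independence of whole processes is independence of these elements. *)
definition process_path :: "(real \<Rightarrow> 'a \<Rightarrow> 'b) \<Rightarrow> 'a \<Rightarrow> real \<Rightarrow> 'b" where
  "process_path Z \<omega> = (\<lambda>t\<in>{0..}. Z t \<omega>)"

abbreviation path_space :: "(real \<Rightarrow> 'b) measure" where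
  "path_space \<equiv> PiM {0..} (\<lambda>_. count_space UNIV)"

context prob_space
begin

(* Paths are nondecreasing and right-continuous on the whole sample space, not just almost
   surely, so that events quantifying over all t in an interval are measurable. Since paths
   are nondecreasing, the truncated subtraction on nat gives the true increments. *)
definition poisson_process :: "real \<Rightarrow> (real \<Rightarrow> 'a \<Rightarrow> nat) \<Rightarrow> bool" where
  "poisson_process rate N \<longleftrightarrow>
     (\<forall>t\<ge>0. N t \<in> measurable M (count_space UNIV)) \<and>
     (\<forall>\<omega>\<in>space M. N 0 \<omega> = 0 \<and> mono_on {0..} (\<lambda>t. N t \<omega>) \<and>
        (\<forall>t\<ge>0. continuous (at_right t) (\<lambda>s. N s \<omega>))) \<and>
     (\<forall>s t. 0 \<le> s \<and> s < t \<longrightarrow>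
        distr M (count_space UNIV) (\<lambda>\<omega>. N t \<omega> - N s \<omega>)
          = measure_pmf (poisson_pmf (rate * (t - s)))) \<and>
     (\<forall>(k::nat) \<tau>. 0 \<le> \<tau> 0 \<and> (\<forall>i<k. \<tau> i < \<tau> (Suc i)) \<longrightarrow>
        indep_vars (\<lambda>_. count_space UNIV) (\<lambda>i \<omega>. N (\<tau> (Suc i)) \<omega> - N (\<tau> i) \<omega>) {..<k})"

definition ct_random_walk :: "int \<Rightarrow> (real \<Rightarrow> 'a \<Rightarrow> int) \<Rightarrow> bool" where
  "ct_random_walk x X \<longleftrightarrow>
     (\<exists>N\<^sub>1 N\<^sub>2. poisson_process (1/2) N\<^sub>1 \<and> poisson_process (1/2) N\<^sub>2 \<and>
        indep_var path_space (process_path N\<^sub>1) path_space (process_path N\<^sub>2) \<and>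
        (\<forall>t\<ge>0. \<forall>\<omega>\<in>space M. X t \<omega> = x + int (N\<^sub>1 t \<omega>) - int (N\<^sub>2 t \<omega>)))"

definition independent_ct_random_walks ::
    "nat \<Rightarrow> (nat \<Rightarrow> int) \<Rightarrow> (nat \<Rightarrow> real \<Rightarrow> 'a \<Rightarrow> int) \<Rightarrow> bool" where
  "independent_ct_random_walks m x X \<longleftrightarrow>
     (\<forall>j\<in>{1..m}. ct_random_walk (x j) (X j)) \<and>
     indep_vars (\<lambda>_. path_space) (\<lambda>j. process_path (X j)) {1..m}"

definition nonintersecting_prob ::
    "nat \<Rightarrow> (nat \<Rightarrow> real \<Rightarrow> 'a \<Rightarrow> int) \<Rightarrow> (nat \<Rightarrow> int) \<Rightarrow> real \<Rightarrow> real" where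
  "nonintersecting_prob m X y T =
     prob {\<omega> \<in> space M. (\<forall>j\<in>{1..m}. X j T \<omega> = y j) \<and>
       (\<forall>t\<in>{0..T}. \<forall>i\<in>{1..m}. \<forall>j\<in>{1..m}. i \<noteq> j \<longrightarrow> X i t \<omega> \<noteq> X j t \<omega>)}"

end

end

theory Submission
  imports Defs "HOL-Real_Asymp.Real_Asymp"
begin

text \<open>
  Observing the walks only at the times \<open>i T / K\<close>, the probability of being pairwise distinct up to
  step \<open>i\<close> and ending at \<open>w\<close> satisfies, up to an error \<open>O(1 / K\<^sup>2)\<close> per step, the Euler scheme of the
  linear system whose generator \<open>H\<close> moves a single walker by a unit step. Right-continuity of the
  paths lets \<open>K\<close> grow along the powers of two, so the probability equals
  \<open>exp (- m T) * (\<Sum>j. (T / 2) ^ j / j! * (H ^ j \<delta>) y)\<close> with \<open>m = n + 2\<close>.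

  On strictly increasing configurations \<open>H = U + D\<close>, where the upward and downward parts \<open>U\<close> and \<open>D\<close>
  commute. Commuting \<open>D\<close> past \<open>U ^ N \<delta>\<close> gives \<open>D (U ^ N \<delta>) \<le> N * U ^ (N - 1) \<delta>\<close> at configurations with
  positive entries, with equality as long as \<open>N \<le> m\<close>. Hence the series equals
  \<open>(T / 2) ^ l / l! * (U ^ l \<delta>) y\<close>, where \<open>l = \<beta>\<^sub>1 + \<beta>\<^sub>2 - 3\<close>, times a series that lies below that of
  \<open>exp (T\<^sup>2 / 4)\<close> and agrees with it in the terms of index at most \<open>m - l\<close>. Finally
  \<open>(U ^ l \<delta>) y\<close> counts standard Young tableaux with at most two rows.
\<close>

section \<open>Up and down operators on ordered configurations\<close>

text \<open>Only neighbouring entries are compared, so moving one walker affects at most two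
  inequalities. Entries outside \<open>1..m\<close> are left free.\<close>

definition chamber :: "nat \<Rightarrow> (nat \<Rightarrow> int) set" where
  "chamber m = {w. \<forall>j\<in>{1..<m}. w j < w (Suc j)}"

text \<open>Forward form: \<open>F\<close> is a mass function, and the value at \<open>w\<close>
  collects the mass of the configurations from which one upward step leads to \<open>w\<close>;
  hence the predecessor \<open>w j - 1\<close>. Mass that leaves the chamber is killed.\<close>

definition up_op :: "nat \<Rightarrow> ((nat \<Rightarrow> int) \<Rightarrow> real) \<Rightarrow> (nat \<Rightarrow> int) \<Rightarrow> real" where
  "up_op m F w = (if w \<in> chamber m then \<Sum>j\<in>{1..m}. F (w(j := w j - 1)) else 0)"

definition down_op :: "nat \<Rightarrow> ((nat \<Rightarrow> int) \<Rightarrow> real) \<Rightarrow> (nat \<Rightarrow> int) \<Rightarrow> real" where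
  "down_op m F w = (if w \<in> chamber m then \<Sum>j\<in>{1..m}. F (w(j := w j + 1)) else 0)"

definition chamber_supported :: "nat \<Rightarrow> ((nat \<Rightarrow> int) \<Rightarrow> real) \<Rightarrow> bool" where
  "chamber_supported m F \<longleftrightarrow> (\<forall>w. w \<notin> chamber m \<longrightarrow> F w = 0)"

lemma chamberD: "w \<in> chamber m \<Longrightarrow> 1 \<le> j \<Longrightarrow> j < m \<Longrightarrow> w j < w (Suc j)"
  by (auto simp: chamber_def)

lemma chamber_less:
  assumes "w \<in> chamber m" "1 \<le> i" "i < j" "j \<le> m"
  shows "w i < w j"
  using assms(3,4)
proof (induction j)
  case (Suc j)
  then show ?case
    using chamberD[OF assms(1), of j] assms(2) by (cases "i = j") force+
qed simp

lemma chamber_inj_on: "w \<in> chamber m \<Longrightarrow> inj_on w {1..m}"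
  by (intro inj_onI) (metis chamber_less atLeastAtMost_iff less_irrefl linorder_neqE_nat)

lemma up_move_in_chamber_iff:
  assumes "w \<in> chamber m" "i \<in> {1..m}"
  shows "w(i := w i + 1) \<in> chamber m \<longleftrightarrow> i = m \<or> w i + 1 < w (Suc i)"
  using assms unfolding chamber_def by (fastforce split: if_splits)

lemma down_move_in_chamber_iff:
  assumes "w \<in> chamber m" "i \<in> {1..m}"
  shows "w(i := w i - 1) \<in> chamber m \<longleftrightarrow> i = 1 \<or> w (i - 1) < w i - 1"
proof
  assume *: "w(i := w i - 1) \<in> chamber m"
  show "i = 1 \<or> w (i - 1) < w i - 1"
    using chamberD[OF *, of "i - 1"] assms(2) by (cases i; cases "i \<le> 1") auto
next
  assume "i = 1 \<or> w (i - 1) < w i - 1"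
  then show "w(i := w i - 1) \<in> chamber m"
    using assms unfolding chamber_def by (auto split: if_splits)
qed

text \<open>Raising \<open>i\<close> endangers only the gap between \<open>i\<close> and
  \<open>Suc i\<close>, and lowering another walker never widens that gap, so a violation would
  survive the second move. Lowering \<open>j\<close> is symmetric, with the gap between
  \<open>j - 1\<close> and \<open>j\<close>.\<close>

lemma opposite_moves_in_chamber:
  assumes w: "w \<in> chamber m" and "i \<noteq> j"
    and v: "w(i := w i + 1, j := w j - 1) \<in> chamber m"
    and ij: "i \<in> {1..m}" "j \<in> {1..m}"
  shows "w(i := w i + 1) \<in> chamber m" "w(j := w j - 1) \<in> chamber m"
proof -
  show "w(i := w i + 1) \<in> chamber m"
    unfolding up_move_in_chamber_iff[OF w ij(1)]
    using chamberD[OF v, of i] ij assms(2) by (cases "Suc i = j"; cases "i = m") auto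
  show "w(j := w j - 1) \<in> chamber m"
    unfolding down_move_in_chamber_iff[OF w ij(2)]
    using chamberD[OF v, of "j - 1"] ij assms(2)
    by (cases j; cases "j \<le> 1"; cases "i = j - 1") auto
qed

text \<open>A gap larger than 1 between neighbours allows one up move (of the lower walker) and one
  down move (of the upper one). The top walker can always rise and the bottom one can always sink,
  so for \<open>m \<ge> 1\<close> both counts are one plus the number of wide gaps.\<close>

lemma card_up_moves_eq_card_down_moves:
  assumes w: "w \<in> chamber m"
  shows "(\<Sum>i\<in>{1..m}. of_bool (w(i := w i + 1) \<in> chamber m) :: real)
       = (\<Sum>i\<in>{1..m}. of_bool (w(i := w i - 1) \<in> chamber m))"
proof (cases m)
  case (Suc k)
  have "(\<Sum>i\<in>{1..m}. of_bool (w(i := w i + 1) \<in> chamber m) :: real)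
      = (\<Sum>i\<in>{1..m}. of_bool (i = m \<or> w i + 1 < w (Suc i)))"
    by (intro sum.cong refl) (use up_move_in_chamber_iff[OF w] in auto)
  also have "\<dots> = (\<Sum>i\<in>{1..k}. of_bool (w i + 1 < w (Suc i))) + 1"
    unfolding Suc by simp
  also have "(\<Sum>i\<in>{1..k}. of_bool (w i + 1 < w (Suc i)) :: real)
      = (\<Sum>i\<in>{Suc 1..Suc k}. of_bool (w (i - 1) < w i - 1))"
    by (subst sum.shift_bounds_cl_Suc_ivl) (intro sum.cong refl, auto)
  also have "\<dots> + 1 = (\<Sum>i\<in>{1..m}. of_bool (i = 1 \<or> w (i - 1) < w i - 1))"
    unfolding Suc by (subst (2) sum.atLeast_Suc_atMost) auto
  also have "\<dots> = (\<Sum>i\<in>{1..m}. of_bool (w(i := w i - 1) \<in> chamber m))"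
    by (intro sum.cong refl) (use down_move_in_chamber_iff[OF w] in auto)
  finally show ?thesis .
qed simp

text \<open>Moves of two different walkers may be made in either order by
  \<open>opposite_moves_in_chamber\<close>. Moving one walker there and back returns to
  \<open>w\<close>, and the number of ways to do so is the same in both orders by
  \<open>card_up_moves_eq_card_down_moves\<close>.\<close>

lemma down_op_up_op_commute:
  assumes F: "chamber_supported m F"
  shows "down_op m (up_op m F) = up_op m (down_op m F)"
proof
  fix w
  show "down_op m (up_op m F) w = up_op m (down_op m F) w"
  proof (cases "w \<in> chamber m")
    case w: True
    \<comment> \<open>\<open>G\<close> holds the terms with two distinct walkers, common to both
      sides; \<open>?c\<close> and \<open>?d\<close> record whether the intermediate configuration
      of a return to \<open>w\<close> is admissible.\<close>
    define G where "G i j = (if i = j then 0 else F (w(i := w i + 1, j := w j - 1)))" for i j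
    let ?c = "\<lambda>i. of_bool (w(i := w i + 1) \<in> chamber m) :: real"
    let ?d = "\<lambda>i. of_bool (w(i := w i - 1) \<in> chamber m) :: real"
    have du: "up_op m F (w(i := w i + 1)) = (\<Sum>j\<in>{1..m}. G i j) + ?c i * F w"
      if i: "i \<in> {1..m}" for i
    proof -
      have "up_op m F (w(i := w i + 1))
          = (\<Sum>j\<in>{1..m}. G i j + (if j = i then ?c i * F w else 0))"
      proof (cases "w(i := w i + 1) \<in> chamber m")
        case True
        then show ?thesis
          unfolding up_op_def by (auto intro!: sum.cong simp: G_def)
      next
        case False
        then have "G i j = 0" if "j \<in> {1..m}" for j
          using opposite_moves_in_chamber(1)[OF w _ _ i that] F
          by (auto simp: G_def chamber_supported_def)
        with False show ?thesis
          by (simp add: up_op_def)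
      qed
      also have "\<dots> = (\<Sum>j\<in>{1..m}. G i j) + ?c i * F w"
        using i by (simp add: sum.distrib)
      finally show ?thesis .
    qed
    have ud: "down_op m F (w(j := w j - 1)) = (\<Sum>i\<in>{1..m}. G i j) + ?d j * F w"
      if j: "j \<in> {1..m}" for j
    proof -
      have "down_op m F (w(j := w j - 1))
          = (\<Sum>i\<in>{1..m}. G i j + (if i = j then ?d j * F w else 0))"
      proof (cases "w(j := w j - 1) \<in> chamber m")
        case True
        then show ?thesis
          unfolding down_op_def by (auto intro!: sum.cong simp: G_def fun_upd_twist)
      next
        case False
        then have "G i j = 0" if "i \<in> {1..m}" for i
          using opposite_moves_in_chamber(2)[OF w _ _ that j] F
          by (auto simp: G_def chamber_supported_def)
        with False show ?thesis
          by (simp add: down_op_def)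
      qed
      also have "\<dots> = (\<Sum>i\<in>{1..m}. G i j) + ?d j * F w"
        using j by (simp add: sum.distrib)
      finally show ?thesis .
    qed
    have "down_op m (up_op m F) w = (\<Sum>i\<in>{1..m}. (\<Sum>j\<in>{1..m}. G i j) + ?c i * F w)"
      using w du by (simp add: down_op_def)
    also have "\<dots> = (\<Sum>j\<in>{1..m}. (\<Sum>i\<in>{1..m}. G i j) + ?d j * F w)"
      using card_up_moves_eq_card_down_moves[OF w]
        sum.swap[of G "{1..m}" "{1..m}"]
      by (simp add: sum.distrib flip: sum_distrib_right)
    also have "\<dots> = up_op m (down_op m F) w"
      using w ud by (simp add: up_op_def)
    finally show ?thesis .
  qed (simp add: up_op_def down_op_def)
qed

lemma chamber_supported_up_op [simp]: "chamber_supported m (up_op m F)"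
  and chamber_supported_down_op [simp]: "chamber_supported m (down_op m F)"
  by (auto simp: chamber_supported_def up_op_def down_op_def)

lemma down_op_scale: "down_op m (\<lambda>w. c * F w) = (\<lambda>w. c * down_op m F w)"
  by (auto simp: down_op_def sum_distrib_left)

lemma down_op_sum: "down_op m (\<lambda>w. \<Sum>a\<in>A. F a w) = (\<lambda>w. \<Sum>a\<in>A. down_op m (F a) w)"
  unfolding down_op_def by (auto simp: fun_eq_iff intro: sum.swap)

lemma up_op_scale: "up_op m (\<lambda>w. c * F w) = (\<lambda>w. c * up_op m F w)"
  by (auto simp: up_op_def sum_distrib_left)

lemma up_op_sum: "up_op m (\<lambda>w. \<Sum>a\<in>A. F a w) = (\<lambda>w. \<Sum>a\<in>A. up_op m (F a) w)"
  unfolding up_op_def by (auto simp: fun_eq_iff intro: sum.swap)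

lemma up_op_down_op_funpow_commute:
  assumes F: "chamber_supported m F"
  shows "up_op m ((down_op m ^^ k) F) = (down_op m ^^ k) (up_op m F)"
proof (induction k)
  case (Suc k)
  have "chamber_supported m ((down_op m ^^ k) F)"
    using F by (cases k) auto
  from down_op_up_op_commute[OF this] Suc show ?case
    by simp
qed simp

lemma chamber_supported_up_op_funpow:
  "chamber_supported m F \<Longrightarrow> chamber_supported m ((up_op m ^^ k) F)"
  by (cases k) auto

section \<open>Powers of the generator as a binomial sum\<close>

definition step_op :: "nat \<Rightarrow> ((nat \<Rightarrow> int) \<Rightarrow> real) \<Rightarrow> (nat \<Rightarrow> int) \<Rightarrow> real" where
  "step_op m F w = up_op m F w + down_op m F w"

text \<open>The binomial theorem for two commuting operators, by Pascal's rule. The down steps are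
  put outermost so that they act on powers of \<open>up_op\<close> applied to the starting
  mass.\<close>

lemma step_op_funpow_binomial:
  assumes F: "chamber_supported m F"
  shows "(step_op m ^^ j) F
    = (\<lambda>w. \<Sum>k\<le>j. real (j choose k) * (down_op m ^^ k) ((up_op m ^^ (j - k)) F) w)"
proof (induction j)
  case (Suc j)
  let ?a = "\<lambda>k l w. (down_op m ^^ k) ((up_op m ^^ l) F) w"
  have "(step_op m ^^ Suc j) F w
      = (\<Sum>k\<le>Suc j. real (Suc j choose k) * ?a k (Suc j - k) w)" for w
  proof -
    have "(step_op m ^^ Suc j) F w
      = (\<Sum>k\<le>j. real (j choose k) * ?a k (Suc (j - k)) w)
       + (\<Sum>k\<le>j. real (j choose k) * ?a (Suc k) (j - k) w)"
      using up_op_down_op_funpow_commute[OF chamber_supported_up_op_funpow[OF F]]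
      by (simp add: Suc step_op_def up_op_sum down_op_sum up_op_scale down_op_scale)
    also have "(\<Sum>k\<le>j. real (j choose k) * ?a k (Suc (j - k)) w)
        = (\<Sum>k\<le>Suc j. real (j choose k) * ?a k (Suc j - k) w)"
      by (simp add: Suc_diff_le)
    also have "\<dots> + (\<Sum>k\<le>j. real (j choose k) * ?a (Suc k) (j - k) w)
        = (\<Sum>k\<le>Suc j. real (Suc j choose k) * ?a k (Suc j - k) w)"
      by (simp add: sum.atMost_Suc_shift sum.distrib ring_distribs del: sum.atMost_Suc)
    finally show ?thesis .
  qed
  then show ?case by (intro ext)
qed simp

section \<open>Upward paths from the packed configuration and the action of down steps on
  them\<close>

definition packed :: "nat \<Rightarrow> (nat \<Rightarrow> int) \<Rightarrow> real" where
  "packed m w = of_bool (\<forall>j\<in>{1..m}. w j = int j)"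

abbreviation displacement :: "nat \<Rightarrow> (nat \<Rightarrow> int) \<Rightarrow> int" where
  "displacement m w \<equiv> (\<Sum>j\<in>{1..m}. w j - int j)"

lemma displacement_upd:
  "j \<in> {1..m} \<Longrightarrow> displacement m (w(j := z)) = displacement m w + (z - w j)"
  by (simp add: sum.remove[where x = j] cong: sum.cong_simp)

lemma chamber_supported_packed: "chamber_supported m (packed m)"
  unfolding chamber_supported_def packed_def chamber_def by fastforce

text \<open>\<open>ups m N w\<close> counts the upward paths of \<open>N\<close> steps inside the
  chamber from the packed configuration to \<open>w\<close>, that is, the standard Young tableaux
  with row lengths \<open>w j - j\<close>.\<close>

definition ups :: "nat \<Rightarrow> nat \<Rightarrow> (nat \<Rightarrow> int) \<Rightarrow> real" where
  "ups m N = (up_op m ^^ N) (packed m)"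

lemma ups_0 [simp]: "ups m 0 = packed m"
  and ups_Suc: "ups m (Suc N) = up_op m (ups m N)"
  by (auto simp: ups_def)

lemma chamber_supported_ups: "chamber_supported m (ups m N)"
  unfolding ups_def by (intro chamber_supported_up_op_funpow chamber_supported_packed)

lemma ups_nonneg: "ups m N w \<ge> 0"
  by (induction N arbitrary: w) (auto simp: packed_def ups_Suc up_op_def intro!: sum_nonneg)

lemma ups_support:
  assumes "ups m N w \<noteq> 0"
  shows "w \<in> chamber m" "m \<ge> 1 \<Longrightarrow> w 1 \<ge> 1" "displacement m w = int N"
proof -
  have "w \<in> chamber m \<and> (m \<ge> 1 \<longrightarrow> w 1 \<ge> 1) \<and> displacement m w = int N"
    using assms
  proof (induction N arbitrary: w)
    case 0
    then show ?case
      by (auto simp: packed_def chamber_def)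
  next
    case (Suc N)
    then have w: "w \<in> chamber m" and "(\<Sum>j\<in>{1..m}. ups m N (w(j := w j - 1))) \<noteq> 0"
      by (auto simp: ups_Suc up_op_def split: if_splits)
    then obtain j where j: "j \<in> {1..m}" "ups m N (w(j := w j - 1)) \<noteq> 0"
      by (meson sum.not_neutral_contains_not_neutral)
    from Suc.IH[OF j(2)] w displacement_upd[OF j(1), of w "w j - 1"] show ?case
      by (auto split: if_splits)
  qed
  then show "w \<in> chamber m" "m \<ge> 1 \<Longrightarrow> w 1 \<ge> 1" "displacement m w = int N"
    by auto
qed

lemma chamber_ge:
  assumes "w \<in> chamber m" "1 \<le> j" "j \<le> m"
  shows "w j \<ge> w 1 + int j - 1"
  using assms(2,3)
proof (induction j)
  case (Suc j)
  then show ?case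
    using chamberD[OF assms(1), of j] by (cases "j = 0") force+
qed simp

text \<open>In the chamber the lowest walker pushes all the others: each of the \<open>m\<close>
  walkers is displaced at least as far as the first.\<close>

lemma displacement_ge:
  assumes "w \<in> chamber m"
  shows "displacement m w \<ge> int m * (w 1 - 1)"
proof -
  have "(\<Sum>j\<in>{1..m}. w 1 - 1) \<le> displacement m w"
    using chamber_ge[OF assms] by (intro sum_mono) force
  then show ?thesis by simp
qed

text \<open>
  Commuting \<^const>\<open>down_op\<close> past one \<^const>\<open>up_op\<close> reproduces the claim for smaller \<open>N\<close> on all
  neighbours of \<open>w\<close> except the one where the lowest walker leaves its origin downwards;
  that neighbour contributes one extra copy of \<open>ups m N w\<close>, and only when \<open>w 1 = 1\<close>.
\<close>

lemma down_op_ups_Suc: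
  assumes m: "m \<ge> 1" and w: "w \<in> chamber m" "w 1 \<ge> 1"
  shows "down_op m (ups m (Suc N)) w
    = (\<Sum>j\<in>{1..m}. if (w(j := w j - 1)) 1 \<ge> 1 then down_op m (ups m N) (w(j := w j - 1)) else 0)
      + of_bool (w 1 = 1) * ups m N w"
proof -
  let ?D = "\<lambda>j. down_op m (ups m N) (w(j := w j - 1))"
  have "?D j = (if (w(j := w j - 1)) 1 \<ge> 1 then ?D j else 0)
      + (if j = 1 then of_bool (w 1 = 1) * ups m N w else 0)" if j: "j \<in> {1..m}" for j
  proof (cases "(w(j := w j - 1)) 1 \<ge> 1")
    case False
    then have j1: "j = 1" and w1: "w 1 = 1"
      using w by (auto split: if_splits)
    \<comment> \<open>Here the lowest walker sits at 0, where \<open>ups\<close> vanishes; of all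
      upward neighbours of \<open>?v\<close> only the one that lifts this walker back to 1, namely
      \<open>w\<close>, contributes.\<close>
    let ?v = "w(1 := 0)"
    have v: "?v \<in> chamber m"
      using w(1) w1 unfolding chamber_def by (force split: if_splits)
    have "?D j = (\<Sum>i\<in>{1..m}. ups m N (?v(i := ?v i + 1)))"
      using j1 w1 v by (simp add: down_op_def)
    also have "\<dots> = (\<Sum>i\<in>{1..m}. if i = 1 then ups m N w else 0)"
    proof (intro sum.cong refl)
      fix i assume "i \<in> {1..m}"
      show "ups m N (?v(i := ?v i + 1)) = (if i = 1 then ups m N w else 0)"
      proof (cases "i = 1")
        case True
        then show ?thesis using w1 by (simp add: fun_upd_idem)
      next
        case False
        then show ?thesis using ups_support(2)[OF _ m, of N "?v(i := ?v i + 1)"] by auto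
      qed
    qed
    also have "\<dots> = ups m N w"
      using m by simp
    finally show ?thesis using False j1 w1 by simp
  qed (use w in \<open>auto split: if_splits\<close>)
  then have "up_op m (down_op m (ups m N)) w
      = (\<Sum>j\<in>{1..m}. (if (w(j := w j - 1)) 1 \<ge> 1 then ?D j else 0)
      + (if j = 1 then of_bool (w 1 = 1) * ups m N w else 0))"
    using w unfolding up_op_def by (auto intro!: sum.cong)
  also have "\<dots> = (\<Sum>j\<in>{1..m}. if (w(j := w j - 1)) 1 \<ge> 1 then ?D j else 0)
      + of_bool (w 1 = 1) * ups m N w"
    using m by (subst sum.distrib) simp
  finally show ?thesis
    using down_op_up_op_commute[OF chamber_supported_ups, of m N] by (simp add: ups_Suc)
qed

lemma down_op_packed:
  assumes m: "m \<ge> 1" and w: "w \<in> chamber m" "w 1 \<ge> 1"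
  shows "down_op m (packed m) w = 0"
proof -
  have "packed m (w(j := w j + 1)) = 0" if j: "j \<in> {1..m}" for j
    using chamber_ge[OF w(1), of j] w j by (auto simp: packed_def intro!: bexI[of _ j])
  then show ?thesis by (simp add: down_op_def)
qed

text \<open>The restriction to lowest entry at least 1 costs nothing, since \<open>ups\<close>
  vanishes elsewhere. At \<open>N = 0\<close> the truncated index \<open>N - 1\<close> is harmless
  because of the factor \<open>real N\<close>.\<close>

lemma restricted_up_op_ups:
  assumes m: "m \<ge> 1" and w: "w \<in> chamber m"
  shows "(\<Sum>j\<in>{1..m}. if (w(j := w j - 1)) 1 \<ge> 1 then real N * ups m (N - 1) (w(j := w j - 1)) else 0)
    = real N * ups m N w"
proof (cases N)
  case (Suc N')
  have eq: "(if v 1 \<ge> 1 then real N * ups m (N - 1) v else 0) = real N * ups m N' v" for v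
    using ups_support(2)[OF _ m, of N' v] Suc by auto
  show ?thesis
    unfolding eq using w Suc by (simp add: ups_Suc up_op_def sum_distrib_left)
qed (auto intro!: sum.neutral)

text \<open>In the induction step the neighbour sum yields \<open>N\<close> copies of
  \<open>ups m N w\<close>, and the boundary term of \<open>down_op_ups_Suc\<close> yields at most
  one more.\<close>

lemma down_op_ups_le:
  assumes m: "m \<ge> 1" and w: "w \<in> chamber m" "w 1 \<ge> 1"
  shows "down_op m (ups m N) w \<le> real N * ups m (N - 1) w"
  using w
proof (induction N arbitrary: w)
  case 0
  then show ?case using down_op_packed[OF m] by simp
next
  case (Suc N)
  have IH: "down_op m (ups m N) v \<le> real N * ups m (N - 1) v" if "v 1 \<ge> 1" for v
    using Suc.IH[of v] that by (cases "v \<in> chamber m") (auto simp: down_op_def ups_nonneg)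
  have "(\<Sum>j\<in>{1..m}. if (w(j := w j - 1)) 1 \<ge> 1 then down_op m (ups m N) (w(j := w j - 1)) else 0)
      \<le> (\<Sum>j\<in>{1..m}. if (w(j := w j - 1)) 1 \<ge> 1 then real N * ups m (N - 1) (w(j := w j - 1)) else 0)"
    using IH by (intro sum_mono) (auto split: if_splits)
  also have "\<dots> = real N * ups m N w"
    by (rule restricted_up_op_ups[OF m Suc.prems(1)])
  finally have "down_op m (ups m (Suc N)) w \<le> real N * ups m N w + of_bool (w 1 = 1) * ups m N w"
    unfolding down_op_ups_Suc[OF m Suc.prems] by simp
  also have "\<dots> \<le> real (Suc N) * ups m N w"
    using ups_nonneg[of m N w] by (simp add: algebra_simps)
  finally show ?case by simp
qed

text \<open>The extra copy is missing only when \<open>w 1 \<ge> 2\<close>. Then the displacement is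
  at least \<open>m\<close>, which exceeds the number of steps used so far, so \<open>ups\<close> is
  zero at \<open>w\<close> and nothing is lost.\<close>

lemma down_op_ups_eq:
  assumes m: "m \<ge> 1" and w: "w \<in> chamber m" "w 1 \<ge> 1" and N: "N \<le> m"
  shows "down_op m (ups m N) w = real N * ups m (N - 1) w"
  using w N
proof (induction N arbitrary: w)
  case 0
  then show ?case using down_op_packed[OF m] by simp
next
  case (Suc N)
  have IH: "down_op m (ups m N) v = real N * ups m (N - 1) v" if "v 1 \<ge> 1" for v
  proof (cases "v \<in> chamber m")
    case True
    then show ?thesis using Suc.IH[of v] that Suc.prems by simp
  next
    case False
    then show ?thesis using chamber_supported_ups[of m "N - 1"]
      by (simp add: down_op_def chamber_supported_def)
  qed
  have "(\<Sum>j\<in>{1..m}. if (w(j := w j - 1)) 1 \<ge> 1 then down_op m (ups m N) (w(j := w j - 1)) else 0)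
      = (\<Sum>j\<in>{1..m}. if (w(j := w j - 1)) 1 \<ge> 1 then real N * ups m (N - 1) (w(j := w j - 1)) else 0)"
    using IH by (intro sum.cong) (auto split: if_splits)
  also have "\<dots> = real N * ups m N w"
    by (rule restricted_up_op_ups[OF m Suc.prems(1)])
  finally have "down_op m (ups m (Suc N)) w = real N * ups m N w + of_bool (w 1 = 1) * ups m N w"
    unfolding down_op_ups_Suc[OF m Suc.prems(1,2)] by simp
  also have "\<dots> = real (Suc N) * ups m N w"
  proof (cases "w 1 = 1 \<or> ups m N w = 0")
    case False
    then have "w 1 \<ge> 2" using Suc.prems by simp
    then have "int m * 1 \<le> int m * (w 1 - 1)" by (intro mult_left_mono) auto
    also have "\<dots> \<le> int N"
      using displacement_ge[OF Suc.prems(1)] ups_support(3)[of m N w] False by simp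
    finally show ?thesis using Suc.prems(3) by simp
  qed (auto simp: algebra_simps)
  finally show ?case by simp
qed

lemma down_op_funpow_nonneg:
  "(\<And>w. F w \<ge> 0) \<Longrightarrow> (down_op m ^^ k) F w \<ge> 0"
  by (induction k arbitrary: w) (auto simp: down_op_def intro!: sum_nonneg)

lemma down_op_funpow_support:
  assumes "(down_op m ^^ k) (ups m N) w \<noteq> 0"
  shows "displacement m w + int k = int N"
  using assms
proof (induction k arbitrary: w)
  case 0
  then show ?case using ups_support(3) by simp
next
  case (Suc k)
  then have "(\<Sum>j\<in>{1..m}. (down_op m ^^ k) (ups m N) (w(j := w j + 1))) \<noteq> 0"
    by (auto simp: down_op_def[of m "(down_op m ^^ k) (ups m N)"] split: if_splits)
  then obtain j where j: "j \<in> {1..m}" "(down_op m ^^ k) (ups m N) (w(j := w j + 1)) \<noteq> 0"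
    by (meson sum.not_neutral_contains_not_neutral)
  from Suc.IH[OF j(2)] displacement_upd[OF j(1), of w "w j + 1"] show ?case
    by simp
qed

text \<open>Each down step strips one up step and contributes the current exponent as a factor, from
  \<open>l + k\<close> down to \<open>l + 1\<close>. For equality all these exponents have to stay
  within \<open>m\<close>.\<close>

lemma down_op_funpow_ups:
  assumes m: "m \<ge> 1" and w: "w \<in> chamber m" "w 1 \<ge> 1"
  shows "(down_op m ^^ k) (ups m (l + k)) w \<le> fact (l + k) / fact l * ups m l w"
    and "l + k \<le> m \<Longrightarrow> (down_op m ^^ k) (ups m (l + k)) w = fact (l + k) / fact l * ups m l w"
proof -
  have "(down_op m ^^ k) (ups m (l + k)) w \<le> fact (l + k) / fact l * ups m l w \<and>
    (l + k \<le> m \<longrightarrow> (down_op m ^^ k) (ups m (l + k)) w = fact (l + k) / fact l * ups m l w)"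
    using w
  proof (induction k arbitrary: w l)
    case (Suc k)
    \<comment> \<open>The outermost down step is peeled off, so the induction hypothesis is taken at
      \<open>Suc l\<close>; it yields the constant \<open>c\<close>, and the peeled step supplies
      the last factor \<open>Suc l\<close>.\<close>
    let ?G = "(down_op m ^^ k) (ups m (Suc l + k))"
    define c :: real where "c = fact (Suc l + k) / fact (Suc l)"
    have supp: "chamber_supported m ?G"
      by (cases k) (auto simp: chamber_supported_ups)
    have IH: "?G v \<le> c * ups m (Suc l) v \<and> (Suc l + k \<le> m \<longrightarrow> ?G v = c * ups m (Suc l) v)"
      if "v 1 \<ge> 1" for v
    proof (cases "v \<in> chamber m")
      case True
      then show ?thesis using Suc.IH[of v "Suc l"] that by (simp add: c_def)
    next
      case False
      then show ?thesis using supp chamber_supported_ups[of m "Suc l"]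
        by (simp add: chamber_supported_def)
    qed
    have "real (Suc l) / fact (Suc l) = 1 / fact l"
      by (simp add: fact_Suc del: of_nat_Suc)
    then have c_eq: "c * real (Suc l) = fact (l + Suc k) / fact l"
      unfolding c_def by (metis add_Suc_shift mult.commute times_divide_eq_left times_divide_eq_right mult_1)
    have IH_up: "?G (w(j := w j + 1)) \<le> c * ups m (Suc l) (w(j := w j + 1))"
      "Suc l + k \<le> m \<Longrightarrow> ?G (w(j := w j + 1)) = c * ups m (Suc l) (w(j := w j + 1))" for j
    proof -
      have "(w(j := w j + 1)) 1 \<ge> 1" using Suc.prems by auto
      from IH[of "w(j := w j + 1)", OF this] show "?G (w(j := w j + 1)) \<le> c * ups m (Suc l) (w(j := w j + 1))"
        "Suc l + k \<le> m \<Longrightarrow> ?G (w(j := w j + 1)) = c * ups m (Suc l) (w(j := w j + 1))"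
        by blast+
    qed
    have eq: "(down_op m ^^ Suc k) (ups m (l + Suc k)) w = down_op m ?G w"
      by simp
    have "down_op m ?G w \<le> c * down_op m (ups m (Suc l)) w"
      using IH_up(1) by (auto simp: down_op_def sum_distrib_left intro!: sum_mono)
    also have "\<dots> \<le> c * (real (Suc l) * ups m l w)"
      using down_op_ups_le[OF m Suc.prems, of "Suc l"] by (intro mult_left_mono) (auto simp: c_def)
    finally have le: "down_op m ?G w \<le> fact (l + Suc k) / fact l * ups m l w"
      using c_eq by (metis mult.assoc)
    have "down_op m ?G w = fact (l + Suc k) / fact l * ups m l w" if lk: "l + Suc k \<le> m"
    proof -
      have "down_op m ?G w = c * down_op m (ups m (Suc l)) w"
        using IH_up(2) lk by (auto simp: down_op_def sum_distrib_left intro!: sum.cong)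
      also have "\<dots> = c * (real (Suc l) * ups m l w)"
        using down_op_ups_eq[OF m Suc.prems, of "Suc l"] lk by simp
      finally show ?thesis using c_eq by (metis mult.assoc)
    qed
    with le eq show ?case by metis
  qed simp
  then show "(down_op m ^^ k) (ups m (l + k)) w \<le> fact (l + k) / fact l * ups m l w"
    "l + k \<le> m \<Longrightarrow> (down_op m ^^ k) (ups m (l + k)) w = fact (l + k) / fact l * ups m l w"
    by auto
qed

section \<open>Counting upward paths that displace only the two top walkers\<close>

lemma two_rows_in_chamber:
  fixes a b n :: nat and w :: "nat \<Rightarrow> int"
  assumes ab: "a \<le> b"
    and w: "\<And>k. k \<in> {1..n} \<Longrightarrow> w k = int k" "w (n + 1) = int (n + 1 + a)" "w (n + 2) = int (n + 2 + b)"
  shows "w \<in> chamber (n + 2)"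
proof -
  have "w j < w (Suc j)" if j: "j \<in> {1..<n+2}" for j
  proof -
    consider "j < n" | "j = n" | "j = n + 1" using j by fastforce
    then show ?thesis using w ab j by cases auto
  qed
  then show ?thesis by (auto simp: chamber_def)
qed

text \<open>The hook length formula for rows \<open>b\<close> and \<open>a\<close>, by induction on
  the number of boxes: the last step moved one of the two top walkers, and the formula satisfies the
  recurrence \<open>f a b = f a (b - 1) + f (a - 1) b\<close>.\<close>

lemma ups_two_rows:
  fixes a b n :: nat and w :: "nat \<Rightarrow> int"
  assumes n: "n \<ge> 1" and ab: "a \<le> b"
    and w: "\<And>k. k \<in> {1..n} \<Longrightarrow> w k = int k" "w (n + 1) = int (n + 1 + a)" "w (n + 2) = int (n + 2 + b)"
  shows "ups (n + 2) (a + b) w = fact (a + b) * (real b - real a + 1) / (fact a * fact (b + 1))"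
  using ab w
proof (induction "a + b" arbitrary: a b w)
  case 0
  have "w j = int j" if "j \<in> {1..n+2}" for j
  proof -
    consider "j \<le> n" | "j = n + 1" | "j = n + 2" using \<open>j \<in> {1..n+2}\<close> by fastforce
    then show ?thesis using 0 that by cases auto
  qed
  then show ?case
    using 0 by (auto simp: packed_def)
next
  case (Suc N)
  have N: "a + b = Suc N" and b: "b \<ge> 1"
    using Suc by auto
  have chamber: "w \<in> chamber (n + 2)"
    by (rule two_rows_in_chamber[OF Suc.prems])
  \<comment> \<open>No upward path reaches a configuration with a walker below its starting place;
    this rules out a last step by any of the first \<open>n\<close> walkers, and by walker
    \<open>n + 1\<close> when \<open>a = 0\<close>.\<close>
  have zero: "ups (n + 2) N v = 0" if "j \<in> {1..n+2}" "v j < int j" for v j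
    using chamber_ge[of v "n + 2" j] ups_support(1,2)[of "n + 2" N v] that by force
  define f :: "nat \<Rightarrow> nat \<Rightarrow> real"
    where "f a b = fact (a + b) * (real b - real a + 1) / (fact a * fact (b + 1))" for a b
  have "ups (n + 2) (a + b) w = (\<Sum>j\<in>{1..n+2}. ups (n + 2) N (w(j := w j - 1)))"
    using chamber by (simp add: N ups_Suc up_op_def)
  also have "{1..n+2} = insert (n + 2) (insert (n + 1) {1..n})"
    by auto
  also have "(\<Sum>j\<in>\<dots>. ups (n + 2) N (w(j := w j - 1)))
      = ups (n + 2) N (w(n + 2 := w (n + 2) - 1)) + ups (n + 2) N (w(n + 1 := w (n + 1) - 1))
        + (\<Sum>j\<in>{1..n}. ups (n + 2) N (w(j := w j - 1)))"
    by simp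
  also have "(\<Sum>j\<in>{1..n}. ups (n + 2) N (w(j := w j - 1))) = 0"
    using Suc.prems by (intro sum.neutral ballI zero) auto
  also have "ups (n + 2) N (w(n + 1 := w (n + 1) - 1)) = (if a = 0 then 0 else f (a - 1) b)"
  proof (cases a)
    case 0
    then show ?thesis
      using zero[of "n + 1" "w(n + 1 := w (n + 1) - 1)"] Suc.prems by simp
  next
    case (Suc a')
    then show ?thesis
      using Suc.hyps(1)[of a' b "w(n + 1 := w (n + 1) - 1)"] Suc.prems N by (simp add: f_def)
  qed
  \<comment> \<open>For \<open>a = b\<close> the lowered top walker collides with the one below it,
    in accordance with the factor \<open>(b - 1) - a + 1 = 0\<close> of the formula.\<close>
  also have "ups (n + 2) N (w(n + 2 := w (n + 2) - 1)) = f a (b - 1)"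
  proof (cases "a = b")
    case True
    have "w(n + 2 := w (n + 2) - 1) \<notin> chamber (n + 2)"
      using Suc.prems True down_move_in_chamber_iff[OF chamber, of "n + 2"] by simp
    then show ?thesis
      using True b chamber_supported_ups[of "n + 2" N]
      by (simp add: f_def chamber_supported_def of_nat_diff)
  next
    case False
    then show ?thesis
      using Suc.hyps(1)[of a "b - 1" "w(n + 2 := w (n + 2) - 1)"] Suc.prems N b
      by (simp add: f_def of_nat_diff)
  qed
  also have "f a (b - 1) + (if a = 0 then 0 else f (a - 1) b) + 0 = f a b"
  proof -
    obtain c where c: "b = Suc c" using b by (cases b) auto
    show ?thesis
    proof (cases a)
      case 0
      then show ?thesis by (simp add: f_def c divide_simps)
    next
      case (Suc d)
      then show ?thesis by (simp add: f_def c divide_simps) (simp add: algebra_simps)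
    qed
  qed
  finally show ?case by (simp add: f_def)
qed

section \<open>The single-walker hopping generator and its exponential series\<close>

definition hop_op :: "nat \<Rightarrow> ((nat \<Rightarrow> int) \<Rightarrow> real) \<Rightarrow> (nat \<Rightarrow> int) \<Rightarrow> real" where
  "hop_op m F w = (if inj_on w {1..m}
     then \<Sum>j\<in>{1..m}. F (w(j := w j - 1)) + F (w(j := w j + 1)) else 0)"

text \<open>\<open>hop_op\<close> tests distinctness only. A change of one entry by at most 1 turns
  a strict inequality of integers into a weak one at worst, and distinctness makes it strict
  again.\<close>

lemma chamber_if_neighbour:
  assumes w: "inj_on w {1..m}" and v: "w(j := z) \<in> chamber m" and z: "\<bar>z - w j\<bar> \<le> 1"
  shows "w \<in> chamber m"
proof -
  have "w i < w (Suc i)" if i: "i \<in> {1..<m}" for i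
  proof -
    have "w i \<noteq> w (Suc i)"
      using inj_onD[OF w, of i "Suc i"] i by auto
    with chamberD[OF v, of i] i z show ?thesis
      by (auto split: if_splits)
  qed
  then show ?thesis by (simp add: chamber_def)
qed

text \<open>Unit steps of single walkers that avoid collisions keep the walkers ordered.\<close>

lemma hop_op_eq_step_op:
  assumes F: "chamber_supported m F"
  shows "hop_op m F = step_op m F"
proof
  fix w
  show "hop_op m F w = step_op m F w"
  proof (cases "w \<in> chamber m")
    case True
    then show ?thesis
      using chamber_inj_on[OF True] by (simp add: hop_op_def step_op_def up_op_def down_op_def sum.distrib)
  next
    case False
    have "F (w(j := z)) = 0" if "inj_on w {1..m}" "\<bar>z - w j\<bar> \<le> 1" for j z
      using chamber_if_neighbour[OF that(1) _ that(2)] False F by (auto simp: chamber_supported_def)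
    with False show ?thesis
      by (simp add: hop_op_def step_op_def up_op_def down_op_def)
  qed
qed

lemma chamber_supported_step_op_funpow:
  "chamber_supported m F \<Longrightarrow> chamber_supported m ((step_op m ^^ k) F)"
  by (cases k) (auto simp: chamber_supported_def step_op_def up_op_def down_op_def)

lemma hop_op_funpow_packed: "(hop_op m ^^ k) (packed m) = (step_op m ^^ k) (packed m)"
  by (induction k)
    (simp_all add: hop_op_eq_step_op chamber_supported_step_op_funpow chamber_supported_packed)

lemma hop_op_mono: "(\<And>v. F v \<le> G v) \<Longrightarrow> hop_op m F w \<le> hop_op m G w"
  unfolding hop_op_def by (auto intro!: sum_mono add_mono)

lemma hop_op_funpow_nonneg:
  "(\<And>w. F w \<ge> 0) \<Longrightarrow> (hop_op m ^^ k) F w \<ge> 0"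
  by (induction k arbitrary: w) (auto simp: hop_op_def intro!: sum_nonneg add_nonneg_nonneg)

text \<open>Each application sums at most \<open>2 * m\<close> neighbouring values. This crude bound
  provides an exponential series as majorant.\<close>

lemma hop_op_funpow_le:
  assumes F: "\<And>w. F w \<le> 1"
  shows "(hop_op m ^^ k) F w \<le> (2 * real m) ^ k"
proof (induction k arbitrary: w)
  case (Suc k)
  have "(\<Sum>j\<in>{1..m}. (hop_op m ^^ k) F (w(j := w j - 1)) + (hop_op m ^^ k) F (w(j := w j + 1)))
      \<le> (\<Sum>j\<in>{1..m}. (2 * real m) ^ k + (2 * real m) ^ k)"
    by (intro sum_mono add_mono Suc)
  then show ?case by (simp add: hop_op_def[of m "(hop_op m ^^ k) F"] mult_ac)
qed (use F in simp)

lemma hop_op_funpow_packed_off_parity: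
  assumes "(hop_op m ^^ j) (packed m) w \<noteq> 0" and l: "displacement m w = int l"
  shows "\<exists>k. j = l + 2 * k"
proof -
  from assms(1) have "(\<Sum>k\<le>j. real (j choose k) * (down_op m ^^ k) (ups m (j - k)) w) \<noteq> 0"
    unfolding hop_op_funpow_packed step_op_funpow_binomial[OF chamber_supported_packed]
    by (simp add: ups_def)
  then obtain k where "k \<le> j" "(down_op m ^^ k) (ups m (j - k)) w \<noteq> 0"
    by (metis (no_types, lifting) atMost_iff mult_zero_right sum.not_neutral_contains_not_neutral)
  with down_op_funpow_support[OF this(2)] l show ?thesis
    by (intro exI[of _ k]) linarith
qed

text \<open>Up steps raise the displacement by one and down steps lower it by one, so a single term
  of the binomial sum survives: \<open>k\<close> steps down and \<open>l + k\<close> up.\<close>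

lemma hop_op_funpow_packed_eq:
  assumes l: "displacement m w = int l"
  shows "(hop_op m ^^ (l + 2 * k)) (packed m) w
    = real ((l + 2 * k) choose k) * (down_op m ^^ k) (ups m (l + k)) w"
proof -
  have "(down_op m ^^ k') (ups m (l + 2 * k - k')) w = 0" if "k' \<le> l + 2 * k" "k' \<noteq> k" for k'
    using down_op_funpow_support[where m = m and k = k' and N = "l + 2 * k - k'" and w = w] l that by force
  then have "(\<Sum>k'\<le>l + 2 * k. real (l + 2 * k choose k') * (down_op m ^^ k') (ups m (l + 2 * k - k')) w)
      = (\<Sum>k'\<in>{k}. real (l + 2 * k choose k') * (down_op m ^^ k') (ups m (l + 2 * k - k')) w)"
    by (intro sum.mono_neutral_right) auto
  moreover have "l + 2 * k - k = l + k" by simp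
  ultimately show ?thesis
    unfolding hop_op_funpow_packed step_op_funpow_binomial[OF chamber_supported_packed]
    by (simp add: ups_def)
qed

text \<open>In the term of index \<open>l + 2 * k\<close> the binomial coefficient,
  \<open>fact (l + 2 * k)\<close> and the factor \<open>fact (l + k) / fact l\<close> from
  \<open>down_op_funpow_ups\<close> combine to \<open>1 / (fact l * fact k)\<close>. What remains is
  the leading term times a term of the series of \<open>exp (s\<^sup>2)\<close>.\<close>

lemma hop_series_bounds:
  fixes s :: real
  assumes m: "m \<ge> 1" and w: "w \<in> chamber m" "w 1 \<ge> 1" and l: "displacement m w = int l"
    and lm: "l \<le> m" and s: "s \<ge> 0"
  defines "A \<equiv> (\<Sum>j. s ^ j / fact j * (hop_op m ^^ j) (packed m) w)"
  shows "A \<le> s ^ l / fact l * ups m l w * exp (s\<^sup>2)"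
    and "A \<ge> s ^ l / fact l * ups m l w * (\<Sum>k\<le>m - l. (s\<^sup>2) ^ k / fact k)"
proof -
  define f where "f j = s ^ j / fact j * (hop_op m ^^ j) (packed m) w" for j
  define G where "G = s ^ l / fact l * ups m l w"
  define h where "h k = f (l + 2 * k)" for k
  have packed: "0 \<le> packed m v" "packed m v \<le> 1" for v
    by (auto simp: packed_def)
  have "summable (\<lambda>j. (2 * real m * s) ^ j /\<^sub>R fact j)"
    by (rule summable_exp_generic)
  then have "summable f"
  proof (rule summable_comparison_test')
    fix j :: nat
    show "norm (f j) \<le> (2 * real m * s) ^ j /\<^sub>R fact j"
      using hop_op_funpow_nonneg[where m = m and k = j and w = w, OF packed(1)]
        hop_op_funpow_le[where m = m and k = j and w = w, OF packed(2)] s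
      by (auto simp: f_def abs_mult power_mult_distrib divide_simps mult.commute intro: mult_left_mono)
  qed
  then have "f sums A" unfolding A_def f_def by (rule summable_sums)
  \<comment> \<open>All terms outside the indices \<open>l + 2 * k\<close> vanish, so the series may
    be reindexed along them.\<close>
  moreover have "strict_mono (\<lambda>k. l + 2 * k)"
    by (auto intro: strict_monoI)
  ultimately have h: "h sums A"
    unfolding h_def using hop_op_funpow_packed_off_parity[OF _ l]
    by (subst sums_mono_reindex[where f = f]) (auto simp: f_def)
  have coeff: "h k = s ^ (l + 2 * k) / (fact k * fact (l + k)) * (down_op m ^^ k) (ups m (l + k)) w" for k
    unfolding h_def f_def hop_op_funpow_packed_eq[OF l]
    by (simp add: binomial_fact field_simps)
  have target: "s ^ (l + 2 * k) / (fact k * fact (l + k)) * (fact (l + k) / fact l * ups m l w)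
      = G * ((s\<^sup>2) ^ k / fact k)" for k
    using power_mult[of s 2 k] by (simp add: G_def power_add field_simps)
  have le: "h k \<le> G * ((s\<^sup>2) ^ k / fact k)" for k
    unfolding coeff target[symmetric]
    by (intro mult_left_mono down_op_funpow_ups(1)[OF m w]) (use s in auto)
  have eq: "h k = G * ((s\<^sup>2) ^ k / fact k)" if "l + k \<le> m" for k
    unfolding coeff target[symmetric] down_op_funpow_ups(2)[OF m w that] ..
  have nonneg: "h k \<ge> 0" for k
    unfolding coeff using s by (intro mult_nonneg_nonneg down_op_funpow_nonneg ups_nonneg) auto
  have "(\<lambda>k. G * ((s\<^sup>2) ^ k / fact k)) sums (G * exp (s\<^sup>2))"
    using sums_mult[OF exp_converges[of "s\<^sup>2"], of G] by (simp add: divide_inverse mult_ac)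
  from sums_le[OF le h this] show "A \<le> s ^ l / fact l * ups m l w * exp (s\<^sup>2)"
    by (simp add: G_def)
  \<comment> \<open>Since \<open>l \<le> m\<close>, the range \<open>k \<le> m - l\<close> is the
    range of equality \<open>l + k \<le> m\<close>; the later terms are nonnegative and are
    dropped.\<close>
  have "G * (\<Sum>k\<le>m - l. (s\<^sup>2) ^ k / fact k) = (\<Sum>k\<le>m - l. h k)"
    using lm eq by (simp add: sum_distrib_left)
  also have "\<dots> \<le> A"
    using sum_le_suminf[OF sums_summable[OF h], of "{..m - l}"] nonneg sums_unique[OF h] by simp
  finally show "A \<ge> s ^ l / fact l * ups m l w * (\<Sum>k\<le>m - l. (s\<^sup>2) ^ k / fact k)"
    by (simp add: G_def)
qed

section \<open>Euler approximation of the hopping semigroup\<close>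

lemma hop_op_add: "hop_op m (\<lambda>w. F w + G w) w = hop_op m F w + hop_op m G w"
  by (simp add: hop_op_def sum.distrib)

lemma hop_op_scale: "hop_op m (\<lambda>w. c * F w) w = c * hop_op m F w"
  by (simp add: hop_op_def sum_distrib_left distrib_left)

lemma hop_op_sum: "hop_op m (\<lambda>w. \<Sum>a\<in>A. F a w) w = (\<Sum>a\<in>A. hop_op m (F a) w)"
  by (induction A rule: infinite_finite_induct) (simp_all add: hop_op_add, simp_all add: hop_op_def)

lemma hop_op_const_le: "c \<ge> 0 \<Longrightarrow> hop_op m (\<lambda>_. c) w \<le> 2 * real m * c"
  by (simp add: hop_op_def)

text \<open>The binomial expansion of \<open>i\<close> Euler steps, that is, of the
  \<open>i\<close>-th power of \<open>1 + h * hop_op m\<close>, applied to the starting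
  mass.\<close>

definition hop_euler :: "nat \<Rightarrow> real \<Rightarrow> nat \<Rightarrow> (nat \<Rightarrow> int) \<Rightarrow> real" where
  "hop_euler m h i w = (\<Sum>j\<le>i. real (i choose j) * h ^ j * (hop_op m ^^ j) (packed m) w)"

lemma hop_euler_Suc: "hop_euler m h (Suc i) w = hop_euler m h i w + h * hop_op m (hop_euler m h i) w"
proof -
  let ?c = "\<lambda>j. (hop_op m ^^ j) (packed m) w"
  have "hop_op m (hop_euler m h i) w = (\<Sum>j\<le>i. real (i choose j) * h ^ j * ?c (Suc j))"
    unfolding hop_euler_def hop_op_sum hop_op_scale by simp
  then have "h * hop_op m (hop_euler m h i) w = (\<Sum>j\<le>i. real (i choose j) * h ^ Suc j * ?c (Suc j))"
    by (simp add: sum_distrib_left mult_ac)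
  moreover have "hop_euler m h i w = (\<Sum>j\<le>Suc i. real (i choose j) * h ^ j * ?c j)"
    by (simp add: hop_euler_def)
  ultimately show ?thesis
    unfolding hop_euler_def[of m h "Suc i"]
    by (simp add: sum.atMost_Suc_shift sum.distrib algebra_simps del: sum.atMost_Suc)
qed

text \<open>The lower bound follows from monotonicity of \<open>hop_op\<close>. For the upper bound,
  \<open>stable\<close> says that one damped Euler step does not enlarge a constant error, so the
  local errors merely add up.\<close>

lemma hop_euler_sandwich:
  fixes a :: "nat \<Rightarrow> (nat \<Rightarrow> int) \<Rightarrow> real"
  assumes q: "q \<ge> 0" and h: "h \<ge> 0" and \<epsilon>: "\<epsilon> \<ge> 0" and stable: "q * (1 + 2 * real m * h) \<le> 1"
    and a0: "a 0 = packed m"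
    and lower: "\<And>i w. i < K \<Longrightarrow> q * (a i w + h * hop_op m (a i) w) \<le> a (Suc i) w"
    and upper: "\<And>i w. i < K \<Longrightarrow> a (Suc i) w \<le> q * (a i w + h * hop_op m (a i) w) + \<epsilon>"
    and i: "i \<le> K"
  shows "q ^ i * hop_euler m h i w \<le> a i w \<and> a i w \<le> q ^ i * hop_euler m h i w + real i * \<epsilon>"
  using i
proof (induction i arbitrary: w)
  case 0
  then show ?case by (simp add: a0 hop_euler_def)
next
  case (Suc i)
  let ?b = "\<lambda>w. q ^ i * hop_euler m h i w"
  have b: "q ^ Suc i * hop_euler m h (Suc i) w = q * (?b w + h * hop_op m ?b w)"
    by (simp add: hop_euler_Suc hop_op_scale algebra_simps)
  have IH: "?b v \<le> a i v" "a i v \<le> ?b v + real i * \<epsilon>" for v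
    using Suc by auto
  have "q * (?b w + h * hop_op m ?b w) \<le> q * (a i w + h * hop_op m (a i) w)"
    using q h IH by (intro mult_left_mono add_mono hop_op_mono) auto
  also have "\<dots> \<le> a (Suc i) w"
    using lower Suc.prems by simp
  finally have 1: "q ^ Suc i * hop_euler m h (Suc i) w \<le> a (Suc i) w"
    unfolding b .
  have "hop_op m (a i) w \<le> hop_op m (\<lambda>v. ?b v + real i * \<epsilon>) w"
    using IH by (intro hop_op_mono) auto
  also have "\<dots> \<le> hop_op m ?b w + 2 * real m * (real i * \<epsilon>)"
    using \<epsilon> hop_op_const_le[of "real i * \<epsilon>" m w] by (simp add: hop_op_add)
  finally have "q * (a i w + h * hop_op m (a i) w)
      \<le> q * ((?b w + real i * \<epsilon>) + h * (hop_op m ?b w + 2 * real m * (real i * \<epsilon>)))"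
    using q h IH by (intro mult_left_mono add_mono) auto
  also have "\<dots> = q * (?b w + h * hop_op m ?b w) + q * (1 + 2 * real m * h) * (real i * \<epsilon>)"
    by (simp add: algebra_simps)
  also have "\<dots> \<le> q * (?b w + h * hop_op m ?b w) + 1 * (real i * \<epsilon>)"
    using stable \<epsilon> by (intro add_left_mono mult_right_mono) auto
  finally have 2: "a (Suc i) w \<le> q ^ Suc i * hop_euler m h (Suc i) w + real (Suc i) * \<epsilon>"
    using upper[of i w] Suc.prems unfolding b by (simp add: algebra_simps)
  from 1 2 show ?case by simp
qed

section \<open>From the Euler scheme to the exponential series\<close>

lemma binomial_over_power_tendsto:
  "(\<lambda>K. real (K choose j) / real K ^ j) \<longlonglongrightarrow> 1 / fact j"
proof (induction j)
  case (Suc j)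
  have "(\<lambda>K. (real K - real j) / real K) \<longlonglongrightarrow> 1"
    by real_asymp
  from tendsto_mult[OF tendsto_divide[OF Suc tendsto_const[of "real (Suc j)"]] this]
  have "(\<lambda>K. real (K choose j) / real K ^ j / real (Suc j) * ((real K - real j) / real K))
      \<longlonglongrightarrow> 1 / fact (Suc j)"
    by (simp add: field_simps)
  moreover have "real (K choose Suc j) / real K ^ Suc j
      = real (K choose j) / real K ^ j / real (Suc j) * ((real K - real j) / real K)" for K
  proof (cases "j \<le> K")
    case True
    have "real (Suc j) * real (K choose Suc j) = (real K - real j) * real (K choose j)"
      using binomial_absorb_comp[of K j] binomial_absorption[of j K] True
      by (metis of_nat_diff of_nat_mult)
    then have "real (K choose Suc j) = (real K - real j) * real (K choose j) / real (Suc j)"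
      by (simp add: field_simps del: of_nat_Suc)
    then show ?thesis by (simp add: mult_ac del: of_nat_Suc)
  qed (simp add: binomial_eq_0)
  ultimately show ?case by simp
qed simp

lemma binomial_times_power_le:
  fixes s :: real
  assumes "s \<ge> 0"
  shows "real (K choose j) * (s / real K) ^ j \<le> s ^ j / fact j"
proof (cases "K = 0")
  case False
  have "real (K choose j) \<le> real K ^ j / fact j"
    using of_nat_mono[OF binomial_fact_pow[of K j], where 'a = real] by (simp add: pos_le_divide_eq)
  then have "real (K choose j) * (s / real K) ^ j \<le> real K ^ j / fact j * (s / real K) ^ j"
    using assms by (intro mult_right_mono) auto
  also have "\<dots> = s ^ j / fact j"
    using False by (simp add: power_divide)
  finally show ?thesis .
qed (use assms in \<open>cases j; simp\<close>)

text \<open>Tannery's theorem: the terms converge one by one and are dominated, uniformly in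
  \<open>K\<close>, by the exponential series of \<open>2 * m * s\<close>.\<close>

lemma hop_euler_tendsto:
  fixes s :: real
  assumes s: "s \<ge> 0"
  shows "(\<lambda>K. hop_euler m (s / real K) K w)
    \<longlonglongrightarrow> (\<Sum>j. s ^ j / fact j * (hop_op m ^^ j) (packed m) w)"
proof -
  let ?c = "\<lambda>j. (hop_op m ^^ j) (packed m) w"
  define f where "f j K = real (K choose j) * (s / real K) ^ j * ?c j" for j K
  have packed: "0 \<le> packed m v" "packed m v \<le> 1" for v
    by (auto simp: packed_def)
  have c: "0 \<le> ?c j" "?c j \<le> (2 * real m) ^ j" for j
    by (intro hop_op_funpow_nonneg packed) (intro hop_op_funpow_le packed)
  have lim: "(\<lambda>K. f j K) \<longlonglongrightarrow> s ^ j / fact j * ?c j" for j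
    using tendsto_mult[OF binomial_over_power_tendsto[of j] tendsto_const[of "s ^ j * ?c j"]]
    by (simp add: f_def power_divide mult_ac)
  have "norm (f j K) \<le> (2 * real m * s) ^ j /\<^sub>R fact j" for j K
  proof -
    have "norm (f j K) = real (K choose j) * (s / real K) ^ j * ?c j"
      using s c(1)[of j] by (simp add: f_def)
    also have "\<dots> \<le> s ^ j / fact j * (2 * real m) ^ j"
      using binomial_times_power_le[OF s] c s by (intro mult_mono) auto
    finally show ?thesis by (simp add: power_mult_distrib field_simps)
  qed
  then have bound: "eventually (\<lambda>(j, K). norm (f j K) \<le> (2 * real m * s) ^ j /\<^sub>R fact j)
      (at_top \<times>\<^sub>F sequentially)"
    by (intro always_eventually) auto
  have "(\<lambda>K. \<Sum>j. f j K) \<longlonglongrightarrow> (\<Sum>j. s ^ j / fact j * ?c j)"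
    using tannerys_theorem[OF lim bound summable_exp_generic] by simp
  moreover have "(\<Sum>j. f j K) = hop_euler m (s / real K) K w" for K
    unfolding hop_euler_def f_def by (rule suminf_finite) auto
  ultimately show ?thesis by simp
qed

lemma exp_minus_times_le_1: "exp (- u) * (1 + u) \<le> 1" for u :: real
  using exp_ge_add_one_self[of u] by (simp add: exp_minus field_simps)

text \<open>With \<open>u = c / K\<close>, the inequality \<open>exp (- u) \<ge> 1 - u\<close>
  bounds the local error by \<open>u\<^sup>2\<close>, so that \<open>K\<close> steps cost at most
  \<open>c\<^sup>2 / K\<close>.\<close>

lemma local_error_tendsto:
  fixes c :: real
  assumes c: "c \<ge> 0"
  shows "(\<lambda>K. real K * (1 - exp (- (c / real K)) * (1 + c / real K))) \<longlonglongrightarrow> 0"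
proof (rule tendsto_sandwich[where f = "\<lambda>_. 0" and h = "\<lambda>K. c\<^sup>2 / real K"])
  show "(\<lambda>K. c\<^sup>2 / real K) \<longlonglongrightarrow> 0"
    by real_asymp
  have "real K * (1 - exp (- (c / real K)) * (1 + c / real K)) \<le> c\<^sup>2 / real K" for K
  proof -
    let ?u = "c / real K"
    have "(1 - ?u) * (1 + ?u) \<le> exp (- ?u) * (1 + ?u)"
      using exp_ge_add_one_self[of "- ?u"] c by (intro mult_right_mono) auto
    then have "real K * (1 - exp (- ?u) * (1 + ?u)) \<le> real K * ?u\<^sup>2"
      by (intro mult_left_mono) (auto simp: power2_eq_square algebra_simps)
    then show ?thesis by (cases "K = 0") (auto simp: power2_eq_square)
  qed
  then show "\<forall>\<^sub>F K in sequentially. real K * (1 - exp (- (c / real K)) * (1 + c / real K)) \<le> c\<^sup>2 / real K"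
    by simp
  show "\<forall>\<^sub>F K in sequentially. 0 \<le> real K * (1 - exp (- (c / real K)) * (1 + c / real K))"
    by (intro always_eventually allI mult_nonneg_nonneg) (auto simp: exp_minus_times_le_1)
qed simp_all

section \<open>Independence of the increments\<close>

context prob_space
begin

text \<open>The walks are prescribed on \<open>space M\<close> only, and independence sees no more,
  since preimages are cut down to \<open>space M\<close>.\<close>

lemma indep_vars_cong_space:
  assumes "\<And>i \<omega>. i \<in> I \<Longrightarrow> \<omega> \<in> space M \<Longrightarrow> X i \<omega> = Y i \<omega>"
  shows "indep_vars M' X I \<longleftrightarrow> indep_vars M' Y I"
proof -
  have "X i -` A \<inter> space M = Y i -` A \<inter> space M" if "i \<in> I" for i A
    using assms[OF that] by auto
  then show ?thesis
    unfolding indep_vars_def2 using assms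
    by (intro conj_cong ball_cong refl measurable_cong indep_sets_cong) auto
qed

text \<open>Independence in two levels: independent objects \<open>P a\<close>, each with
  independent functionals \<open>f a l\<close>, give a jointly independent family. Probabilities
  factor first over \<open>a\<close> and then over \<open>l\<close>.\<close>

lemma indep_vars_Times:
  fixes f :: "'i \<Rightarrow> 'j \<Rightarrow> 'b \<Rightarrow> 'c"
  assumes fin: "finite A" "A \<noteq> {}" "finite L" "L \<noteq> {}"
    and outer: "indep_vars N P A"
    and f: "\<And>a l. a \<in> A \<Longrightarrow> l \<in> L \<Longrightarrow> f a l \<in> measurable (N a) (count_space UNIV)"
    and inner: "\<And>a. a \<in> A \<Longrightarrow> indep_vars (\<lambda>_. count_space UNIV) (\<lambda>l \<omega>. f a l (P a \<omega>)) L"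
  shows "indep_vars (\<lambda>_. count_space UNIV) (\<lambda>(a, l) \<omega>. f a l (P a \<omega>)) (A \<times> L)"
proof -
  have P: "P a \<in> measurable M (N a)" if "a \<in> A" for a
    using outer that by (auto simp: indep_vars_def)
  have rv: "random_variable (count_space UNIV) ((\<lambda>(a, l) \<omega>. f a l (P a \<omega>)) i)" if "i \<in> A \<times> L" for i
    using that measurable_compose[OF P f] by auto
  have "prob (\<Inter>i\<in>A \<times> L. (\<lambda>(a, l) \<omega>. f a l (P a \<omega>)) i -` S i \<inter> space M)
      = (\<Prod>i\<in>A \<times> L. prob ((\<lambda>(a, l) \<omega>. f a l (P a \<omega>)) i -` S i \<inter> space M))" for S
  proof -
    \<comment> \<open>\<open>B a\<close> gathers all conditions on the single object
      \<open>P a\<close> into one event, to which the outer independence applies.\<close>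
    define B where "B a = (\<Inter>l\<in>L. f a l -` S (a, l) \<inter> space (N a))" for a
    have B: "B a \<in> sets (N a)" if "a \<in> A" for a
      unfolding B_def using fin f[OF that] by (intro sets.finite_INT measurable_sets) auto
    have P_B: "P a -` B a \<inter> space M = (\<Inter>l\<in>L. (\<lambda>\<omega>. f a l (P a \<omega>)) -` S (a, l) \<inter> space M)"
      if "a \<in> A" for a
      unfolding B_def using fin(4) measurable_space[OF P[OF that]] by blast
    have "(\<Inter>i\<in>A \<times> L. (\<lambda>(a, l) \<omega>. f a l (P a \<omega>)) i -` S i \<inter> space M)
        = (\<Inter>a\<in>A. \<Inter>l\<in>L. (\<lambda>\<omega>. f a l (P a \<omega>)) -` S (a, l) \<inter> space M)"
      by auto
    also have "\<dots> = (\<Inter>a\<in>A. P a -` B a \<inter> space M)"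
      by (intro INF_cong refl) (simp only: P_B)
    finally have "prob (\<Inter>i\<in>A \<times> L. (\<lambda>(a, l) \<omega>. f a l (P a \<omega>)) i -` S i \<inter> space M)
        = (\<Prod>a\<in>A. prob (P a -` B a \<inter> space M))"
      using indep_varsD[OF outer _ _ subset_refl B] fin by simp
    also have "\<dots> = (\<Prod>a\<in>A. \<Prod>l\<in>L. prob ((\<lambda>\<omega>. f a l (P a \<omega>)) -` S (a, l) \<inter> space M))"
    proof (intro prod.cong refl)
      fix a assume a: "a \<in> A"
      show "prob (P a -` B a \<inter> space M) = (\<Prod>l\<in>L. prob ((\<lambda>\<omega>. f a l (P a \<omega>)) -` S (a, l) \<inter> space M))"
        unfolding P_B[OF a] using indep_varsD[OF inner[OF a], of L "\<lambda>l. S (a, l)"] fin by simp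
    qed
    finally show ?thesis
      by (simp add: prod.cartesian_product case_prod_unfold)
  qed
  then show ?thesis
    using fin rv
    by (subst indep_vars_finite[where E = "\<lambda>_. Pow UNIV"])
      (auto simp: Int_stable_def sigma_sets_top intro: sigma_sets.Basic)
qed

end

section \<open>Increments of a single walk over a time grid\<close>

lemma measurable_path_increment:
  assumes "s \<ge> 0" "t \<ge> 0"
  shows "(\<lambda>p. p t - p s :: 'b :: {countable, minus}) \<in> measurable path_space (count_space UNIV)"
\<comment> \<open>The difference is split over the countably many values of \<open>p s\<close>; for
  each of them only one coordinate remains.\<close>
proof (rule measurable_compose_countable[where f = "\<lambda>i p. p t - i" and g = "\<lambda>p. p s"])
  show "(\<lambda>p. p t - i) \<in> measurable path_space (count_space UNIV)" for i :: 'b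
    using assms by (intro measurable_compose[OF measurable_component_singleton[of t]]) auto
  show "(\<lambda>p. p s :: 'b) \<in> measurable path_space (count_space UNIV)"
    using assms by (intro measurable_component_singleton) auto
qed

lemma process_path_apply: "t \<ge> 0 \<Longrightarrow> process_path Z \<omega> t = Z t \<omega>"
  by (simp add: process_path_def)

context prob_space
begin

lemma poisson_process_increment_prob:
  assumes N: "poisson_process rate N" and st: "0 \<le> s" "s < t" and rate: "rate > 0"
  shows "prob ((\<lambda>\<omega>. N t \<omega> - N s \<omega>) -` {k} \<inter> space M)
    = (rate * (t - s)) ^ k / fact k * exp (- (rate * (t - s)))"
proof -
  have N_meas: "N r \<in> measurable M (count_space UNIV)" if "r \<ge> 0" for r
    using N that by (simp add: poisson_process_def)
  have meas: "(\<lambda>\<omega>. N t \<omega> - N s \<omega>) \<in> measurable M (count_space UNIV)"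
    by (rule measurable_compose_countable[where f = "\<lambda>i \<omega>. N t \<omega> - i" and g = "N s"])
      (use st N_meas in \<open>auto intro: measurable_compose[OF N_meas]\<close>)
  have "distr M (count_space UNIV) (\<lambda>\<omega>. N t \<omega> - N s \<omega>) = measure_pmf (poisson_pmf (rate * (t - s)))"
    using N st by (simp add: poisson_process_def)
  then have "prob ((\<lambda>\<omega>. N t \<omega> - N s \<omega>) -` {k} \<inter> space M) = measure (poisson_pmf (rate * (t - s))) {k}"
    using measure_distr[OF meas, of "{k}"] by simp
  also have "\<dots> = (rate * (t - s)) ^ k / fact k * exp (- (rate * (t - s)))"
    using st rate by (simp add: measure_pmf_single)
  finally show ?thesis .
qed

lemma poisson_process_increments_indep:
  assumes N: "poisson_process rate N" and "\<delta> > 0"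
  shows "indep_vars (\<lambda>_. count_space UNIV)
    (\<lambda>l \<omega>. N (real (Suc l) * \<delta>) \<omega> - N (real l * \<delta>) \<omega>) {..<K}"
proof -
  have "\<forall>(k::nat) \<tau>. 0 \<le> \<tau> 0 \<and> (\<forall>i<k. \<tau> i < \<tau> (Suc i)) \<longrightarrow>
      indep_vars (\<lambda>_. count_space UNIV) (\<lambda>i \<omega>. N (\<tau> (Suc i)) \<omega> - N (\<tau> i) \<omega>) {..<k}"
    using N unfolding poisson_process_def by (elim conjE)
  from this[rule_format, of "\<lambda>l. real l * \<delta>" K] assms(2) show ?thesis
    by simp
qed

text \<open>Over a step of length \<delta> the two Poisson increments are independent with mean
  \<open>\<delta> / 2\<close>. Each lower bound keeps one pair of values: (0, 0) for no move, (1, 0)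
  or (0, 1) for a unit move.\<close>

lemma ct_random_walk_step_prob:
  assumes X: "ct_random_walk x X" and \<delta>: "\<delta> > 0"
  defines "D \<equiv> \<lambda>(l::nat) \<omega>. X (real (Suc l) * \<delta>) \<omega> - X (real l * \<delta>) \<omega>"
  shows "exp (- \<delta>) \<le> prob {\<omega> \<in> space M. D l \<omega> = 0}" (is ?zero)
    and "\<sigma> \<in> {1, -1} \<Longrightarrow> \<delta> / 2 * exp (- \<delta>) \<le> prob {\<omega> \<in> space M. D l \<omega> = \<sigma>}" (is "_ \<Longrightarrow> ?one")
    and "indep_vars (\<lambda>_. count_space UNIV) D {..<K}" (is ?indep)
    and "D l \<in> measurable M (count_space UNIV)"
proof -
  obtain N1 N2 where N: "poisson_process (1/2) N1" "poisson_process (1/2) N2"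
    and indep: "indep_var path_space (process_path N1) path_space (process_path N2)"
    and X_eq: "\<And>t \<omega>. t \<ge> 0 \<Longrightarrow> \<omega> \<in> space M \<Longrightarrow> X t \<omega> = x + int (N1 t \<omega>) - int (N2 t \<omega>)"
    using X unfolding ct_random_walk_def by auto
  define inc :: "nat \<Rightarrow> (real \<Rightarrow> nat) \<Rightarrow> nat"
    where "inc l p = p (real (Suc l) * \<delta>) - p (real l * \<delta>)" for l p
  have inc_meas: "inc l \<in> measurable path_space (count_space UNIV)" for l
    unfolding inc_def using \<delta> by (intro measurable_path_increment) auto
  have inc_eq: "inc l (process_path N' \<omega>) = N' (real (Suc l) * \<delta>) \<omega> - N' (real l * \<delta>) \<omega>" for l N' \<omega>
    using \<delta> by (simp add: inc_def process_path_apply)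
  \<comment> \<open>Paths are nondecreasing, so the truncated subtraction in \<open>inc\<close>
    loses nothing.\<close>
  have int_inc: "int (inc l (process_path N' \<omega>)) = int (N' (real (Suc l) * \<delta>) \<omega>) - int (N' (real l * \<delta>) \<omega>)"
    if "poisson_process (1/2) N'" "\<omega> \<in> space M" for l N' \<omega>
  proof -
    have "mono_on {0..} (\<lambda>t. N' t \<omega>)"
      using that by (simp add: poisson_process_def)
    then have "N' (real l * \<delta>) \<omega> \<le> N' (real (Suc l) * \<delta>) \<omega>"
      by (rule mono_onD) (use \<delta> in auto)
    then show ?thesis by (simp add: inc_eq of_nat_diff)
  qed
  have D_eq: "D l \<omega> = int (inc l (process_path N1 \<omega>)) - int (inc l (process_path N2 \<omega>))"
    if "\<omega> \<in> space M" for l \<omega>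
    using that int_inc[OF N(1) that] int_inc[OF N(2) that] \<delta> X_eq[OF _ that] by (simp add: D_def)
  have inc_rv: "(\<lambda>\<omega>. inc l (process_path N' \<omega>)) \<in> measurable M (count_space UNIV)" if "N' \<in> {N1, N2}" for l N'
    using that measurable_compose[OF _ inc_meas] indep_var_rv1[OF indep] indep_var_rv2[OF indep] by auto
  have D_meas: "D l \<in> measurable M (count_space UNIV)" for l
  proof -
    have "(\<lambda>\<omega>. int (inc l (process_path N1 \<omega>)) - int (inc l (process_path N2 \<omega>))) \<in> measurable M (count_space UNIV)"
      by (rule measurable_compose_countable[where f = "\<lambda>i \<omega>. int i - int (inc l (process_path N2 \<omega>))"
            and g = "\<lambda>\<omega>. inc l (process_path N1 \<omega>)"])
        (auto intro: measurable_compose[OF inc_rv] inc_rv)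
    then show ?thesis
      by (subst measurable_cong[OF D_eq])
  qed
  then show "D l \<in> measurable M (count_space UNIV)" .
  have pair: "(\<delta> / 2) ^ a / fact a * exp (- (\<delta> / 2)) * ((\<delta> / 2) ^ b / fact b * exp (- (\<delta> / 2)))
      \<le> prob {\<omega> \<in> space M. D l \<omega> = int a - int b}" for a b
  proof -
    have inc_prob: "prob ((\<lambda>\<omega>. inc l (process_path N' \<omega>)) -` {k} \<inter> space M)
        = (\<delta> / 2) ^ k / fact k * exp (- (\<delta> / 2))" if "poisson_process (1/2) N'" for N' k
      unfolding inc_eq using poisson_process_increment_prob[OF that, of "real l * \<delta>" "real (Suc l) * \<delta>"] \<delta>
      by (simp add: algebra_simps)
    have "indep_var (count_space UNIV) (inc l \<circ> process_path N1) (count_space UNIV) (inc l \<circ> process_path N2)"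
      by (rule indep_var_compose[OF indep inc_meas inc_meas])
    from indep_varD[OF this, of "{a}" "{b}"]
    have "(\<delta> / 2) ^ a / fact a * exp (- (\<delta> / 2)) * ((\<delta> / 2) ^ b / fact b * exp (- (\<delta> / 2)))
      = prob ((\<lambda>\<omega>. (inc l (process_path N1 \<omega>), inc l (process_path N2 \<omega>))) -` ({a} \<times> {b}) \<inter> space M)"
      using N by (simp add: comp_def inc_prob)
    also have "\<dots> \<le> prob {\<omega> \<in> space M. D l \<omega> = int a - int b}"
    proof (intro finite_measure_mono)
      have "{\<omega> \<in> space M. D l \<omega> = int a - int b} = D l -` {int a - int b} \<inter> space M"
        by auto
      then show "{\<omega> \<in> space M. D l \<omega> = int a - int b} \<in> events"
        using measurable_sets[OF D_meas[of l]] by simp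
    qed (use D_eq in auto)
    finally show ?thesis .
  qed
  have exp_half: "exp (- (\<delta> / 2)) * exp (- (\<delta> / 2)) = exp (- \<delta>)"
    by (simp flip: exp_add)
  show ?zero
    using pair[of 0 0] by (simp add: exp_half)
  show ?one if "\<sigma> \<in> {1, -1}"
    using that pair[of 1 0] pair[of 0 1] exp_half by (auto simp: mult_ac)
  show ?indep
  proof (cases "K = 0")
    case True
    then show ?thesis by (simp add: indep_vars_def2 indep_sets_def)
  next
    case False
    \<comment> \<open>The two processes form a family indexed by \<open>bool\<close>. All their
      increments are jointly independent by \<open>indep_vars_Times\<close>; grouping the two
      increments of each step \<open>l\<close> into the block \<open>?B l\<close> and taking
      differences yields the walk.\<close>
    let ?P = "case_bool (process_path N1) (process_path N2)"
    let ?Y = "\<lambda>(b, l) \<omega>. inc l (?P b \<omega>)"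
    let ?B = "\<lambda>l. (UNIV :: bool set) \<times> {l}"
    have "case_bool path_space path_space = (\<lambda>_. path_space :: (real \<Rightarrow> nat) measure)"
      by (auto split: bool.split)
    then have outer: "indep_vars (\<lambda>_. path_space) ?P UNIV"
      using indep by (simp add: indep_var_def)
    have inner: "indep_vars (\<lambda>_. count_space UNIV) (\<lambda>l \<omega>. inc l (?P b \<omega>)) {..<K}" for b
      using N[THEN poisson_process_increments_indep, OF \<delta>, of K] by (cases b) (simp_all add: inc_eq)
    have "indep_vars (\<lambda>_. count_space UNIV) ?Y (UNIV \<times> {..<K})"
      by (rule indep_vars_Times[where f = "\<lambda>_. inc", OF _ _ _ _ outer]) (use False inc_meas inner in auto)
    then have "indep_vars (\<lambda>l. PiM (?B l) (\<lambda>_. count_space UNIV)) (\<lambda>l \<omega>. restrict (\<lambda>i. ?Y i \<omega>) (?B l)) {..<K}"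
      by (rule indep_vars_restrict) (auto simp: disjoint_family_on_def)
    then have "indep_vars (\<lambda>_. count_space UNIV)
        (\<lambda>l \<omega>. (\<lambda>d. int (d (True, l)) - int (d (False, l))) (restrict (\<lambda>i. ?Y i \<omega>) (?B l))) {..<K}"
      by (rule indep_vars_compose2) (subst count_space_PiM_finite, auto)
    then show ?thesis
      by (subst indep_vars_cong_space) (auto simp: D_eq)
  qed
qed

end

section \<open>One step of the time grid for all walkers\<close>

definition unit_moves :: "nat \<Rightarrow> (nat \<Rightarrow> int) set" where
  "unit_moves m = insert (\<lambda>_. 0) ((\<lambda>(j, \<sigma>). (\<lambda>_. 0)(j := \<sigma>)) ` ({1..m} \<times> {1, -1}))"

lemma finite_unit_moves: "finite (unit_moves m)"
  by (simp add: unit_moves_def)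

lemma unit_moves_cases:
  assumes "\<xi> \<in> unit_moves m" "\<xi> \<noteq> (\<lambda>_. 0)"
  obtains j \<sigma> where "j \<in> {1..m}" "\<sigma> \<in> {1, -1}" "\<xi> = (\<lambda>_. 0)(j := \<sigma>)"
proof -
  have "\<xi> \<in> (\<lambda>(j, \<sigma>). (\<lambda>_. 0)(j := \<sigma>)) ` ({1..m} \<times> {1, -1})"
    using assms by (simp add: unit_moves_def)
  then obtain p where p: "\<xi> = (\<lambda>(j, \<sigma>). (\<lambda>_. 0)(j := \<sigma>)) p" "p \<in> {1..m} \<times> {1, -1}"
    by (rule imageE)
  show thesis
    by (rule that[of "fst p" "snd p"]) (use p in \<open>auto simp: case_prod_unfold\<close>)
qed

lemma sum_unit_moves:
  "(\<Sum>\<xi>\<in>unit_moves m. F \<xi>)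
    = F (\<lambda>_. 0) + (\<Sum>j\<in>{1..m}. F ((\<lambda>_. 0)(j := 1)) + F ((\<lambda>_. 0)(j := -1)))"
proof -
  let ?e = "\<lambda>(j, \<sigma>). (\<lambda>_. 0 :: int)(j := \<sigma>)"
  have inj: "inj_on ?e ({1..m} \<times> {1, -1})"
  proof (intro inj_onI)
    fix p p' assume "p \<in> {1..m} \<times> {1, - 1 :: int}" "p' \<in> {1..m} \<times> {1, - 1 :: int}" "?e p = ?e p'"
    then show "p = p'"
      by (cases p; cases p') (auto dest: fun_cong[where x = "fst p"] fun_cong[where x = "fst p'"] split: if_splits)
  qed
  have "(\<lambda>_. 0) \<notin> ?e ` ({1..m} \<times> {1, -1})"
  proof
    assume "(\<lambda>_. 0) \<in> ?e ` ({1..m} \<times> {1, -1})"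
    then obtain p where p: "(\<lambda>_. 0) = ?e p" "p \<in> {1..m} \<times> {1, -1}"
      by (rule imageE)
    from fun_cong[OF p(1), of "fst p"] p(2) show False by auto
  qed
  then have "(\<Sum>\<xi>\<in>unit_moves m. F \<xi>) = F (\<lambda>_. 0) + (\<Sum>\<xi>\<in>?e ` ({1..m} \<times> {1, -1}). F \<xi>)"
    unfolding unit_moves_def by (subst sum.insert) auto
  also have "(\<Sum>\<xi>\<in>?e ` ({1..m} \<times> {1, -1}). F \<xi>) = (\<Sum>(j, \<sigma>)\<in>{1..m} \<times> {1, -1}. F ((\<lambda>_. 0)(j := \<sigma>)))"
    by (subst sum.reindex[OF inj]) (auto intro!: sum.cong)
  also have "\<dots> = (\<Sum>j\<in>{1..m}. \<Sum>\<sigma>\<in>{1, -1}. F ((\<lambda>_. 0)(j := \<sigma>)))"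
    by (rule sum.cartesian_product[symmetric])
  finally show ?thesis by simp
qed

context prob_space
begin

lemma walk_increments_indep:
  assumes X: "independent_ct_random_walks m x X" and \<delta>: "\<delta> > 0" and "m \<ge> 1" "K \<ge> 1"
  shows "indep_vars (\<lambda>_. count_space UNIV)
    (\<lambda>(j, l) \<omega>. X j (real (Suc l) * \<delta>) \<omega> - X j (real l * \<delta>) \<omega>) ({1..m} \<times> {..<K})"
proof -
  let ?inc = "\<lambda>(l :: nat) p. p (real (Suc l) * \<delta>) - p (real l * \<delta>) :: int"
  have inc_eq: "?inc l (process_path (X j) \<omega>) = X j (real (Suc l) * \<delta>) \<omega> - X j (real l * \<delta>) \<omega>" for l j \<omega>
    using \<delta> by (simp add: process_path_apply)
  have "indep_vars (\<lambda>_. count_space UNIV) (\<lambda>(j, l) \<omega>. ?inc l (process_path (X j) \<omega>)) ({1..m} \<times> {..<K})"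
  proof (rule indep_vars_Times[where f = "\<lambda>_. ?inc"])
    show "indep_vars (\<lambda>_. path_space) (\<lambda>j. process_path (X j)) {1..m}"
      using X by (simp add: independent_ct_random_walks_def)
    show "?inc l \<in> measurable path_space (count_space UNIV)" for l
      using \<delta> by (intro measurable_path_increment) auto
    fix j assume "j \<in> {1..m}"
    then have "ct_random_walk (x j) (X j)"
      using X by (simp add: independent_ct_random_walks_def)
    from ct_random_walk_step_prob(3)[OF this \<delta>]
    show "indep_vars (\<lambda>_. count_space UNIV) (\<lambda>l \<omega>. ?inc l (process_path (X j) \<omega>)) {..<K}"
      unfolding inc_eq .
  qed (use assms in \<open>auto simp: lessThan_empty_iff\<close>)
  then show ?thesis unfolding inc_eq .
qed

lemma ct_random_walk_eq_sum_increments: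
  assumes "ct_random_walk x X" "\<omega> \<in> space M"
  shows "X (real l * \<delta>) \<omega> = x + (\<Sum>k<l. X (real (Suc k) * \<delta>) \<omega> - X (real k * \<delta>) \<omega>)"
proof -
  have "X 0 \<omega> = x"
    using assms by (auto simp: ct_random_walk_def poisson_process_def)
  then show ?thesis
    using sum_lessThan_telescope[of "\<lambda>k. X (real k * \<delta>) \<omega>" l] by simp
qed

definition grid_event :: "nat \<Rightarrow> (nat \<Rightarrow> real \<Rightarrow> 'a \<Rightarrow> int) \<Rightarrow> real \<Rightarrow> nat \<Rightarrow> (nat \<Rightarrow> int) \<Rightarrow> 'a set" where
  "grid_event m X \<delta> i w = {\<omega> \<in> space M. (\<forall>l\<le>i. inj_on (\<lambda>j. X j (real l * \<delta>) \<omega>) {1..m}) \<and>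
     (\<forall>j\<in>{1..m}. X j (real i * \<delta>) \<omega> = w j)}"

definition step_event :: "nat \<Rightarrow> (nat \<Rightarrow> real \<Rightarrow> 'a \<Rightarrow> int) \<Rightarrow> real \<Rightarrow> nat \<Rightarrow> (nat \<Rightarrow> int) \<Rightarrow> 'a set" where
  "step_event m X \<delta> i \<xi> = {\<omega> \<in> space M. \<forall>j\<in>{1..m}.
     X j (real (Suc i) * \<delta>) \<omega> - X j (real i * \<delta>) \<omega> = \<xi> j}"

text \<open>The grid event is determined by the increments before step \<open>i\<close> and the step
  event by those of step \<open>i\<close>. These are disjoint blocks of one independent family,
  hence the product formula.\<close>

lemma
  assumes X: "independent_ct_random_walks m x X" and \<delta>: "\<delta> > 0" and m: "m \<ge> 1"
  shows grid_event_measurable: "grid_event m X \<delta> i w \<in> events"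
    and step_event_measurable: "step_event m X \<delta> i \<xi> \<in> events"
    and prob_grid_event_Int_step_event: "prob (grid_event m X \<delta> i w \<inter> step_event m X \<delta> i \<xi>)
      = prob (grid_event m X \<delta> i w) * prob (step_event m X \<delta> i \<xi>)"
    and prob_step_event: "prob (step_event m X \<delta> i \<xi>)
      = (\<Prod>j\<in>{1..m}. prob {\<omega> \<in> space M. X j (real (Suc i) * \<delta>) \<omega> - X j (real i * \<delta>) \<omega> = \<xi> j})"
proof -
  let ?D = "\<lambda>(j, l) \<omega>. X j (real (Suc l) * \<delta>) \<omega> - X j (real l * \<delta>) \<omega>"
  let ?A = "{1..m} \<times> {..<i}" and ?B = "{1..m} \<times> {i}"
  let ?VA = "\<lambda>\<omega>. restrict (\<lambda>p. ?D p \<omega>) ?A" and ?VB = "\<lambda>\<omega>. restrict (\<lambda>p. ?D p \<omega>) ?B"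
  let ?PA = "PiM ?A (\<lambda>_. count_space (UNIV :: int set))" and ?PB = "PiM ?B (\<lambda>_. count_space (UNIV :: int set))"
  \<comment> \<open>The two events as sets of increment arrays, with positions written as partial
    sums. The finite product of discrete countable spaces is discrete, so both sets are
    measurable.\<close>
  define SA where "SA = {d \<in> PiE ?A (\<lambda>_. UNIV). (\<forall>l\<le>i. inj_on (\<lambda>j. x j + (\<Sum>k<l. d (j, k))) {1..m}) \<and>
     (\<forall>j\<in>{1..m}. x j + (\<Sum>k<i. d (j, k)) = w j)}"
  define SB where "SB = {d \<in> PiE ?B (\<lambda>_. UNIV). \<forall>j\<in>{1..m}. d (j, i) = \<xi> j}"
  have SA: "SA \<in> sets ?PA" and SB: "SB \<in> sets ?PB"
    by (subst count_space_PiM_finite; auto simp: SA_def SB_def)+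
  have D: "indep_vars (\<lambda>_. count_space UNIV) ?D ({1..m} \<times> {..<Suc i})"
    using walk_increments_indep[OF X \<delta> m, of "Suc i"] by simp
  have indep: "indep_var ?PA ?VA ?PB ?VB"
    by (rule indep_var_restrict[OF D]) auto
  have pos: "X j (real l * \<delta>) \<omega> = x j + (\<Sum>k<l. ?VA \<omega> (j, k))"
    if "j \<in> {1..m}" "l \<le> i" "\<omega> \<in> space M" for j l \<omega>
  proof -
    have "ct_random_walk (x j) (X j)"
      using X that by (simp add: independent_ct_random_walks_def)
    from ct_random_walk_eq_sum_increments[OF this that(3), of l \<delta>] show ?thesis
      using that by (auto intro!: sum.cong)
  qed
  have "inj_on (\<lambda>j. X j (real l * \<delta>) \<omega>) {1..m} = inj_on (\<lambda>j. x j + (\<Sum>k<l. ?VA \<omega> (j, k))) {1..m}"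
    if "l \<le> i" "\<omega> \<in> space M" for l \<omega>
    by (rule inj_on_cong) (rule pos[OF _ that])
  then have grid_eq: "grid_event m X \<delta> i w = ?VA -` SA \<inter> space M"
    unfolding grid_event_def SA_def using pos[of _ i] by (auto simp del: restrict_apply)
  have step_eq: "step_event m X \<delta> i \<xi> = ?VB -` SB \<inter> space M"
    unfolding step_event_def SB_def by auto
  show "grid_event m X \<delta> i w \<in> events"
    unfolding grid_eq by (rule measurable_sets[OF indep_var_rv1[OF indep] SA])
  show "step_event m X \<delta> i \<xi> \<in> events"
    unfolding step_eq by (rule measurable_sets[OF indep_var_rv2[OF indep] SB])
  show "prob (grid_event m X \<delta> i w \<inter> step_event m X \<delta> i \<xi>)
      = prob (grid_event m X \<delta> i w) * prob (step_event m X \<delta> i \<xi>)"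
  proof -
    have "grid_event m X \<delta> i w \<inter> step_event m X \<delta> i \<xi> = (\<lambda>\<omega>. (?VA \<omega>, ?VB \<omega>)) -` (SA \<times> SB) \<inter> space M"
      unfolding grid_eq step_eq by auto
    then show ?thesis
      unfolding grid_eq step_eq using indep_varD[OF indep SA SB] by simp
  qed
  have "step_event m X \<delta> i \<xi> = (\<Inter>p\<in>?B. ?D p -` {\<xi> (fst p)} \<inter> space M)"
    unfolding step_event_def using m by auto
  then have "prob (step_event m X \<delta> i \<xi>) = (\<Prod>p\<in>?B. prob (?D p -` {\<xi> (fst p)} \<inter> space M))"
    using indep_varsD[OF D, of ?B "\<lambda>p. {\<xi> (fst p)}"] m by auto
  also have "\<dots> = (\<Prod>j\<in>{1..m}. prob (?D (j, i) -` {\<xi> j} \<inter> space M))"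
    using prod.cartesian_product[of "\<lambda>j l. prob (?D (j, l) -` {\<xi> j} \<inter> space M)" "{i}" "{1..m}"]
    by (simp add: case_prod_unfold)
  also have "\<dots> = (\<Prod>j\<in>{1..m}. prob {\<omega> \<in> space M. X j (real (Suc i) * \<delta>) \<omega> - X j (real i * \<delta>) \<omega> = \<xi> j})"
    by (intro prod.cong arg_cong[where f = prob]) auto
  finally show "prob (step_event m X \<delta> i \<xi>)
      = (\<Prod>j\<in>{1..m}. prob {\<omega> \<in> space M. X j (real (Suc i) * \<delta>) \<omega> - X j (real i * \<delta>) \<omega> = \<xi> j})" .
qed

text \<open>Every walker contributes \<open>exp (- \<delta>)\<close>, and the at most one walker
  that moves contributes a further \<open>\<delta> / 2\<close>.\<close>

lemma prob_step_event_ge: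
  assumes X: "independent_ct_random_walks m x X" and \<delta>: "\<delta> > 0" and m: "m \<ge> 1"
    and \<xi>: "\<xi> \<in> unit_moves m"
  shows "exp (- (real m * \<delta>)) * (if \<xi> = (\<lambda>_. 0) then 1 else \<delta> / 2) \<le> prob (step_event m X \<delta> i \<xi>)"
proof -
  have walk: "ct_random_walk (x j) (X j)" if "j \<in> {1..m}" for j
    using X that by (simp add: independent_ct_random_walks_def)
  let ?p = "\<lambda>j. prob {\<omega> \<in> space M. X j (real (Suc i) * \<delta>) \<omega> - X j (real i * \<delta>) \<omega> = \<xi> j}"
  have le: "exp (- \<delta>) * (if \<xi> j = 0 then 1 else \<delta> / 2) \<le> ?p j" if "j \<in> {1..m}" for j
  proof (cases "\<xi> j = 0")
    case True
    then show ?thesis using ct_random_walk_step_prob(1)[OF walk[OF that] \<delta>, of i] by simp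
  next
    case False
    then have "\<xi> j \<in> {1, -1}"
      using \<xi> by (auto simp: unit_moves_def split: if_splits)
    from ct_random_walk_step_prob(2)[OF walk[OF that] \<delta> this, of i] False show ?thesis
      by (simp add: mult.commute)
  qed
  have "(\<Prod>j\<in>{1..m}. if \<xi> j = 0 then 1 else \<delta> / 2) = (if \<xi> = (\<lambda>_. 0) then 1 else \<delta> / 2)"
  proof (cases "\<xi> = (\<lambda>_. 0)")
    case False
    then obtain k \<sigma> where k: "k \<in> {1..m}" "\<sigma> \<in> {1, -1}" "\<xi> = (\<lambda>_. 0)(k := \<sigma>)"
      using unit_moves_cases[OF \<xi>] by metis
    then have "(\<Prod>j\<in>{1..m}. if \<xi> j = 0 then 1 else \<delta> / 2) = (\<Prod>j\<in>{1..m}. if j = k then \<delta> / 2 else 1)"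
      by (intro prod.cong) auto
    with False k show ?thesis by simp
  qed simp
  moreover have "exp (- \<delta>) ^ m = exp (- (real m * \<delta>))"
    by (simp flip: exp_of_nat_mult)
  ultimately have "exp (- (real m * \<delta>)) * (if \<xi> = (\<lambda>_. 0) then 1 else \<delta> / 2)
      = (\<Prod>j\<in>{1..m}. exp (- \<delta>) * (if \<xi> j = 0 then 1 else \<delta> / 2))"
    by (simp only: prod.distrib prod_constant card_atLeastAtMost) simp
  also have "\<dots> \<le> (\<Prod>j\<in>{1..m}. ?p j)"
    using le \<delta> by (intro prod_mono) auto
  also have "\<dots> = prob (step_event m X \<delta> i \<xi>)"
    by (rule prob_step_event[OF X \<delta> m, symmetric])
  finally show ?thesis .
qed

text \<open>Unit moves vanish outside \<open>1..m\<close>, so two of them that describe the same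
  increments of the walkers coincide.\<close>

lemma disjoint_step_events: "disjoint_family_on (step_event m X \<delta> i) (unit_moves m)"
proof -
  have "\<xi> = \<xi>'" if "\<xi> \<in> unit_moves m" "\<xi>' \<in> unit_moves m" "\<forall>j\<in>{1..m}. \<xi> j = \<xi>' j" for \<xi> \<xi>'
  proof
    fix j
    have z: "\<eta> j = 0" if "\<eta> \<in> unit_moves m" "j \<notin> {1..m}" for \<eta>
      using that by (auto simp: unit_moves_def)
    show "\<xi> j = \<xi>' j"
      using that z[OF that(1)] z[OF that(2)] by (cases "j \<in> {1..m}") (blast, simp)
  qed
  then show ?thesis
    unfolding disjoint_family_on_def step_event_def by fastforce
qed

lemma grid_event_not_inj_on: "\<not> inj_on w {1..m} \<Longrightarrow> grid_event m X \<delta> i w = {}"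
proof -
  have "inj_on w {1..m}" if "\<omega> \<in> grid_event m X \<delta> i w" for \<omega>
  proof -
    have "inj_on (\<lambda>j. X j (real i * \<delta>) \<omega>) {1..m}" "\<forall>j\<in>{1..m}. X j (real i * \<delta>) \<omega> = w j"
      using that by (auto simp: grid_event_def)
    moreover from this(2) have "inj_on (\<lambda>j. X j (real i * \<delta>) \<omega>) {1..m} = inj_on w {1..m}"
      by (intro inj_on_cong) blast
    ultimately show ?thesis by blast
  qed
  then show "\<not> inj_on w {1..m} \<Longrightarrow> grid_event m X \<delta> i w = {}" by auto
qed

text \<open>
  Lower bounds on the probabilities of the unit moves suffice: their defects, together with the
  probability of all other steps, add up to exactly \<open>1 - q * (1 + m * \<delta>)\<close>.
\<close>

lemma grid_event_Suc_bounds: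
  assumes X: "independent_ct_random_walks m x X" and \<delta>: "\<delta> > 0" and m: "m \<ge> 1"
  defines "a \<equiv> \<lambda>i w. prob (grid_event m X \<delta> i w)"
    and "q \<equiv> exp (- (real m * \<delta>))"
  shows "q * (a i w + \<delta> / 2 * hop_op m (a i) w) \<le> a (Suc i) w"
    and "a (Suc i) w \<le> q * (a i w + \<delta> / 2 * hop_op m (a i) w) + (1 - q * (1 + real m * \<delta>))"
proof -
  have "q * (a i w + \<delta> / 2 * hop_op m (a i) w) \<le> a (Suc i) w \<and>
    a (Suc i) w \<le> q * (a i w + \<delta> / 2 * hop_op m (a i) w) + (1 - q * (1 + real m * \<delta>))"
  proof (cases "inj_on w {1..m}")
    case False
    then show ?thesis
      using exp_minus_times_le_1[of "real m * \<delta>"] by (simp add: a_def q_def hop_op_def grid_event_not_inj_on)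
  next
    case inj: True
    let ?S = "unit_moves m"
    let ?w = "\<lambda>\<xi> k. w k - \<xi> k"
    let ?B = "step_event m X \<delta> i"
    let ?C = "\<lambda>\<xi>. grid_event m X \<delta> i (?w \<xi>) \<inter> ?B \<xi>"
    \<comment> \<open>\<open>r\<close> is the guaranteed part of the probability of a move. Summed
      against the predecessors \<open>?w \<xi>\<close> it gives exactly one damped Euler step of
      size \<open>\<delta> / 2\<close>.\<close>
    define r where "r \<xi> = q * (if \<xi> = (\<lambda>_. 0) then 1 else \<delta> / 2)" for \<xi> :: "nat \<Rightarrow> int"
    have nz: "(\<lambda>_. 0)(j := 1) \<noteq> (\<lambda>_. 0 :: int)" "(\<lambda>_. 0)(j := - 1) \<noteq> (\<lambda>_. 0 :: int)" for j :: nat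
      by (metis fun_upd_same one_neq_zero, metis fun_upd_same neg_equal_0_iff_equal one_neq_zero)
    have sub: "(\<lambda>k. w k - ((\<lambda>_. 0)(j := \<sigma>)) k) = w(j := w j - \<sigma>)" for j \<sigma>
      by auto
    have sum_r: "(\<Sum>\<xi>\<in>?S. r \<xi>) = q * (1 + real m * \<delta>)"
      by (subst sum_unit_moves) (simp add: r_def nz algebra_simps)
    have sum_ar: "(\<Sum>\<xi>\<in>?S. a i (?w \<xi>) * r \<xi>) = q * (a i w + \<delta> / 2 * hop_op m (a i) w)"
      unfolding sum_unit_moves sub hop_op_def using inj
      by (simp add: r_def nz sum_distrib_left algebra_simps)
    have r_le: "r \<xi> \<le> prob (?B \<xi>)" if "\<xi> \<in> ?S" for \<xi>
      using prob_step_event_ge[OF X \<delta> m that] by (simp add: r_def q_def)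
    have sets: "?B \<xi> \<in> events" "grid_event m X \<delta> i v \<in> events" "?C \<xi> \<in> events" for \<xi> v
      using step_event_measurable[OF X \<delta> m] grid_event_measurable[OF X \<delta> m] by auto
    have C: "prob (?C \<xi>) = a i (?w \<xi>) * prob (?B \<xi>)" for \<xi>
      unfolding a_def by (rule prob_grid_event_Int_step_event[OF X \<delta> m])
    have "disjoint_family_on ?C ?S"
      using disjoint_step_events[of m X \<delta> i] unfolding disjoint_family_on_def by blast
    then have U: "prob (\<Union>\<xi>\<in>?S. ?C \<xi>) = (\<Sum>\<xi>\<in>?S. a i (?w \<xi>) * prob (?B \<xi>))"
      using sets finite_measure_finite_Union[of ?S ?C] finite_unit_moves C by auto
    have UB: "prob (\<Union>\<xi>\<in>?S. ?B \<xi>) = (\<Sum>\<xi>\<in>?S. prob (?B \<xi>))"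
      using sets finite_measure_finite_Union[of ?S ?B] finite_unit_moves disjoint_step_events by auto
    have UB_sets: "(\<Union>\<xi>\<in>?S. ?B \<xi>) \<in> events" and UC_sets: "(\<Union>\<xi>\<in>?S. ?C \<xi>) \<in> events"
      using sets finite_unit_moves by (auto intro!: sets.finite_UN)
    have "(\<Union>\<xi>\<in>?S. ?C \<xi>) \<subseteq> grid_event m X \<delta> (Suc i) w"
    proof
      fix \<omega> assume "\<omega> \<in> (\<Union>\<xi>\<in>?S. ?C \<xi>)"
      then obtain \<xi> where g: "\<omega> \<in> grid_event m X \<delta> i (?w \<xi>)" and b: "\<omega> \<in> ?B \<xi>" by auto
      have eq: "X j (real (Suc i) * \<delta>) \<omega> = w j" if "j \<in> {1..m}" for j
      proof -
        have "X j (real (Suc i) * \<delta>) \<omega> - X j (real i * \<delta>) \<omega> = \<xi> j" "X j (real i * \<delta>) \<omega> = w j - \<xi> j"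
          using that g b unfolding step_event_def grid_event_def by blast+
        then show ?thesis by linarith
      qed
      have "inj_on (\<lambda>j. X j (real (Suc i) * \<delta>) \<omega>) {1..m} = inj_on w {1..m}"
        by (rule inj_on_cong) (rule eq)
      with eq inj g show "\<omega> \<in> grid_event m X \<delta> (Suc i) w"
        unfolding grid_event_def le_Suc_eq by blast
    qed
    then have "prob (\<Union>\<xi>\<in>?S. ?C \<xi>) \<le> a (Suc i) w"
      unfolding a_def by (intro finite_measure_mono grid_event_measurable[OF X \<delta> m])
    then have lower: "(\<Sum>\<xi>\<in>?S. a i (?w \<xi>) * prob (?B \<xi>)) \<le> a (Suc i) w"
      unfolding U .
    \<comment> \<open>Either the last step was a unit move, and then the configuration before it is
      known, or it was none of them, which has the complementary probability.\<close>
    have "grid_event m X \<delta> (Suc i) w \<subseteq> (\<Union>\<xi>\<in>?S. ?C \<xi>) \<union> (space M - (\<Union>\<xi>\<in>?S. ?B \<xi>))"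
    proof
      fix \<omega> assume g: "\<omega> \<in> grid_event m X \<delta> (Suc i) w"
      have "\<omega> \<in> ?C \<xi>" if b: "\<omega> \<in> ?B \<xi>" for \<xi>
      proof -
        have "X j (real i * \<delta>) \<omega> = w j - \<xi> j" if "j \<in> {1..m}" for j
        proof -
          have "X j (real (Suc i) * \<delta>) \<omega> - X j (real i * \<delta>) \<omega> = \<xi> j" "X j (real (Suc i) * \<delta>) \<omega> = w j"
            using that g b unfolding step_event_def grid_event_def by blast+
          then show ?thesis by linarith
        qed
        with g b show ?thesis unfolding grid_event_def le_Suc_eq by blast
      qed
      with g show "\<omega> \<in> (\<Union>\<xi>\<in>?S. ?C \<xi>) \<union> (space M - (\<Union>\<xi>\<in>?S. ?B \<xi>))"
        unfolding grid_event_def by blast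
    qed
    then have "a (Suc i) w \<le> prob ((\<Union>\<xi>\<in>?S. ?C \<xi>) \<union> (space M - (\<Union>\<xi>\<in>?S. ?B \<xi>)))"
      unfolding a_def using UB_sets UC_sets by (intro finite_measure_mono) auto
    also have "\<dots> \<le> prob (\<Union>\<xi>\<in>?S. ?C \<xi>) + prob (space M - (\<Union>\<xi>\<in>?S. ?B \<xi>))"
      using UB_sets UC_sets by (intro measure_Un_le) auto
    also have "\<dots> = (\<Sum>\<xi>\<in>?S. a i (?w \<xi>) * prob (?B \<xi>)) + (1 - (\<Sum>\<xi>\<in>?S. prob (?B \<xi>)))"
      using UB_sets by (simp only: U UB prob_compl)
    finally have upper: "a (Suc i) w \<le> (\<Sum>\<xi>\<in>?S. a i (?w \<xi>) * prob (?B \<xi>)) + (1 - (\<Sum>\<xi>\<in>?S. prob (?B \<xi>)))" .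
    have "(\<Sum>\<xi>\<in>?S. a i (?w \<xi>) * r \<xi>) \<le> (\<Sum>\<xi>\<in>?S. a i (?w \<xi>) * prob (?B \<xi>))"
      using r_le by (intro sum_mono mult_left_mono) (auto simp: a_def)
    with lower have 1: "(\<Sum>\<xi>\<in>?S. a i (?w \<xi>) * r \<xi>) \<le> a (Suc i) w" by linarith
    \<comment> \<open>As \<open>a\<close> takes values at most 1, each defect weighted by
      \<open>a\<close> is at most the defect itself.\<close>
    have "(\<Sum>\<xi>\<in>?S. a i (?w \<xi>) * (prob (?B \<xi>) - r \<xi>)) \<le> (\<Sum>\<xi>\<in>?S. 1 * (prob (?B \<xi>) - r \<xi>))"
      using r_le by (intro sum_mono mult_right_mono) (auto simp: a_def)
    then have "(\<Sum>\<xi>\<in>?S. a i (?w \<xi>) * prob (?B \<xi>)) - (\<Sum>\<xi>\<in>?S. prob (?B \<xi>))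
        \<le> (\<Sum>\<xi>\<in>?S. a i (?w \<xi>) * r \<xi>) - (\<Sum>\<xi>\<in>?S. r \<xi>)"
      by (simp add: right_diff_distrib sum_subtractf)
    with upper have 2: "a (Suc i) w \<le> (\<Sum>\<xi>\<in>?S. a i (?w \<xi>) * r \<xi>) + (1 - (\<Sum>\<xi>\<in>?S. r \<xi>))"
      by linarith
    from 1 2 show ?thesis unfolding sum_ar sum_r by blast
  qed
  then show "q * (a i w + \<delta> / 2 * hop_op m (a i) w) \<le> a (Suc i) w"
    "a (Suc i) w \<le> q * (a i w + \<delta> / 2 * hop_op m (a i) w) + (1 - q * (1 + real m * \<delta>))"
    by auto
qed

end

section \<open>The non-intersection probability as a series\<close>

context prob_space
begin

text \<open>For values in a discrete space, right-continuity means being constant on a short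
  interval to the right.\<close>

lemma ct_random_walk_right_continuous:
  assumes X: "ct_random_walk x X" and "\<omega> \<in> space M" "t \<ge> 0"
  shows "eventually (\<lambda>s. X s \<omega> = X t \<omega>) (at_right t)"
proof -
  obtain N1 N2 where N: "poisson_process (1/2) N1" "poisson_process (1/2) N2"
    and X_eq: "\<And>t. t \<ge> 0 \<Longrightarrow> X t \<omega> = x + int (N1 t \<omega>) - int (N2 t \<omega>)"
    using assms unfolding ct_random_walk_def by auto
  have "eventually (\<lambda>s. N' s \<omega> = N' t \<omega>) (at_right t)" if "poisson_process (1/2) N'" for N'
  proof -
    have "continuous (at_right t) (\<lambda>s. N' s \<omega>)"
      using that assms by (simp add: poisson_process_def)
    then show ?thesis by (simp add: continuous_within tendsto_discrete)
  qed
  from this[OF N(1)] this[OF N(2)] eventually_at_right_less[of t] show ?thesis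
    by eventually_elim (use X_eq assms in auto)
qed

text \<open>A collision at time \<open>t\<close> persists on some interval from \<open>t\<close> to
  the right, and a fine enough dyadic grid has a point in it.\<close>

lemma nonintersecting_event_eq_INT_grid_events:
  assumes X: "independent_ct_random_walks m x X" and T: "T > 0" and y: "inj_on y {1..m}"
  shows "{\<omega> \<in> space M. (\<forall>j\<in>{1..m}. X j T \<omega> = y j) \<and>
       (\<forall>t\<in>{0..T}. \<forall>i\<in>{1..m}. \<forall>j\<in>{1..m}. i \<noteq> j \<longrightarrow> X i t \<omega> \<noteq> X j t \<omega>)}
    = (\<Inter>r. grid_event m X (T / 2 ^ r) (2 ^ r) y)" (is "?E = ?G")
proof (rule set_eqI, rule iffI)
  fix \<omega> assume \<omega>: "\<omega> \<in> ?E"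
  show "\<omega> \<in> ?G"
  proof
    fix r :: nat
    have grid: "real l * (T / 2 ^ r) \<in> {0..T}" if "l \<le> 2 ^ r" for l
    proof -
      have "real l \<le> 2 ^ r" using of_nat_mono[OF that, where 'a = real] by simp
      then show ?thesis using T by (simp add: field_simps)
    qed
    have "inj_on (\<lambda>j. X j (real l * (T / 2 ^ r)) \<omega>) {1..m}" if "l \<le> 2 ^ r" for l
      using grid[OF that] \<omega> by (intro inj_onI) blast
    then show "\<omega> \<in> grid_event m X (T / 2 ^ r) (2 ^ r) y"
      using \<omega> by (simp add: grid_event_def)
  qed
next
  fix \<omega> assume G: "\<omega> \<in> ?G"
  then have "\<omega> \<in> grid_event m X (T / 2 ^ 0) (2 ^ 0) y"
    by blast
  then have \<omega>: "\<omega> \<in> space M" and end_eq: "\<forall>j\<in>{1..m}. X j T \<omega> = y j"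
    by (simp_all add: grid_event_def)
  have "X i t \<omega> \<noteq> X j t \<omega>" if t: "t \<in> {0..T}" and ij: "i \<in> {1..m}" "j \<in> {1..m}" "i \<noteq> j" for t i j
  proof
    assume eq: "X i t \<omega> = X j t \<omega>"
    have "eventually (\<lambda>s. X k s \<omega> = X k t \<omega>) (at_right t)" if "k \<in> {1..m}" for k
      using X \<omega> t that by (intro ct_random_walk_right_continuous) (auto simp: independent_ct_random_walks_def)
    from this[OF ij(1)] this[OF ij(2)] have "eventually (\<lambda>s. X i s \<omega> = X j s \<omega>) (at_right t)"
      by eventually_elim (use eq in simp)
    then obtain b where b: "b > t" "\<And>s. t < s \<Longrightarrow> s < b \<Longrightarrow> X i s \<omega> = X j s \<omega>"
      unfolding eventually_at_right_field by auto
    obtain r where r: "T / (b - t) < 2 ^ r"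
      using real_arch_pow[of 2 "T / (b - t)"] by auto
    then have r': "T / 2 ^ r < b - t"
      using b(1) by (simp add: field_simps)
    \<comment> \<open>Rounding up gives a grid time \<open>?s\<close> with
      \<open>t \<le> ?s < t + T / 2 ^ r < b\<close>, and \<open>t \<le> T\<close> keeps
      \<open>l \<le> 2 ^ r\<close>; for \<open>t = T\<close> the grid time is \<open>T\<close>
      itself.\<close>
    define l where "l = nat \<lceil>t * 2 ^ r / T\<rceil>"
    have l_ge: "real l \<ge> t * 2 ^ r / T" and l_less: "real l < t * 2 ^ r / T + 1"
      using t T unfolding l_def by (simp_all add: of_nat_nat) linarith+
    have "t * 2 ^ r / T \<le> 2 ^ r"
      using t T by (simp add: field_simps)
    with l_less have "real l < real (2 ^ r + 1)" by simp
    then have l: "l \<le> 2 ^ r" by (simp only: of_nat_less_iff)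
    let ?s = "real l * (T / 2 ^ r)"
    have "t \<le> ?s" using l_ge T by (simp add: field_simps)
    moreover have "?s < t + T / 2 ^ r" using l_less T by (simp add: field_simps)
    ultimately have "X i ?s \<omega> = X j ?s \<omega>"
      using b(2)[of ?s] eq r' by (cases "?s = t") auto
    moreover have "inj_on (\<lambda>j. X j ?s \<omega>) {1..m}"
      using G l by (auto simp: grid_event_def)
    ultimately show False using ij by (auto dest: inj_onD)
  qed
  with \<omega> end_eq show "\<omega> \<in> ?E" by auto
qed

text \<open>Halving the step refines the grid. This nesting is what the powers of two are
  for.\<close>

lemma decseq_grid_events: "decseq (\<lambda>r. grid_event m X (T / 2 ^ r) (2 ^ r) y)"
proof (rule decseq_SucI, rule subsetI)
  fix r \<omega> assume \<omega>: "\<omega> \<in> grid_event m X (T / 2 ^ Suc r) (2 ^ Suc r) y"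
  have eq: "real l * (T / 2 ^ r) = real (2 * l) * (T / 2 ^ Suc r)" for l
    by simp
  have "inj_on (\<lambda>j. X j (real l * (T / 2 ^ r)) \<omega>) {1..m}" if "l \<le> 2 ^ r" for l
  proof -
    have "2 * l \<le> 2 ^ Suc r" using that by simp
    then show ?thesis unfolding eq using \<omega> unfolding grid_event_def by blast
  qed
  moreover have "real (2 ^ r) * (T / 2 ^ r) = real (2 ^ Suc r) * (T / 2 ^ Suc r)"
    by simp
  ultimately show "\<omega> \<in> grid_event m X (T / 2 ^ r) (2 ^ r) y"
    using \<omega> unfolding grid_event_def by simp
qed

text \<open>For \<open>K\<close> steps the grid probability lies between \<open>?h K\<close> and
  \<open>?h K + ?e K\<close>; both tend to the series. Along powers of two the grid events decrease
  to the non-intersection event.\<close>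

theorem nonintersecting_prob_eq_hop_series:
  assumes X: "independent_ct_random_walks m x X" and m: "m \<ge> 1" and T: "T > 0"
    and x: "\<And>j. j \<in> {1..m} \<Longrightarrow> x j = int j" and y: "inj_on y {1..m}"
  shows "nonintersecting_prob m X y T
    = exp (- (real m * T)) * (\<Sum>j. (T / 2) ^ j / fact j * (hop_op m ^^ j) (packed m) y)"
proof -
  define p where "p K = prob (grid_event m X (T / real K) K y)" for K
  let ?h = "\<lambda>K. exp (- (real m * T)) * hop_euler m (T / 2 / real K) K y"
  let ?e = "\<lambda>K. real K * (1 - exp (- (real m * T / real K)) * (1 + real m * T / real K))"
  have start: "(\<lambda>w. prob (grid_event m X \<delta> 0 w)) = packed m" for \<delta>
  proof
    fix w
    have X0: "X j 0 \<omega> = int j" if "j \<in> {1..m}" "\<omega> \<in> space M" for j \<omega>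
    proof -
      have "ct_random_walk (x j) (X j)"
        using X that by (simp add: independent_ct_random_walks_def)
      from ct_random_walk_eq_sum_increments[OF this that(2), of 0] x[OF that(1)] show ?thesis
        by simp
    qed
    have "grid_event m X \<delta> 0 w = (if \<forall>j\<in>{1..m}. int j = w j then space M else {})"
    proof -
      have "inj_on (\<lambda>j. X j 0 \<omega>) {1..m}" if "\<omega> \<in> space M" for \<omega>
        by (intro inj_onI) (use X0[OF _ that] in auto)
      then show ?thesis by (auto simp: grid_event_def X0)
    qed
    moreover have "packed m w = (if \<forall>j\<in>{1..m}. int j = w j then 1 else 0)"
      unfolding packed_def of_bool_def by metis
    ultimately show "prob (grid_event m X \<delta> 0 w) = packed m w"
      by (simp add: prob_space)
  qed
  have sandwich: "?h K \<le> p K \<and> p K \<le> ?h K + ?e K" if K: "K \<ge> 1" for K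
  proof -
    define \<delta> where "\<delta> = T / real K"
    let ?q = "exp (- (real m * \<delta>))"
    have \<delta>: "\<delta> > 0" using T K by (simp add: \<delta>_def)
    have "?q ^ K * hop_euler m (\<delta> / 2) K y \<le> prob (grid_event m X \<delta> K y) \<and>
      prob (grid_event m X \<delta> K y) \<le> ?q ^ K * hop_euler m (\<delta> / 2) K y + real K * (1 - ?q * (1 + real m * \<delta>))"
    proof (rule hop_euler_sandwich[where a = "\<lambda>i w. prob (grid_event m X \<delta> i w)" and K = K])
      show "1 - ?q * (1 + real m * \<delta>) \<ge> 0" "?q * (1 + 2 * real m * (\<delta> / 2)) \<le> 1"
        using exp_minus_times_le_1[of "real m * \<delta>"] by simp_all
    qed (use \<delta> start grid_event_Suc_bounds[OF X \<delta> m] in auto)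
    moreover have "?q ^ K = exp (- (real m * T))"
      using K by (simp add: \<delta>_def flip: exp_of_nat_mult)
    moreover have "\<delta> / 2 = T / 2 / real K" by (simp add: \<delta>_def)
    ultimately show ?thesis by (simp add: \<delta>_def p_def mult.commute)
  qed
  let ?lim = "exp (- (real m * T)) * (\<Sum>j. (T / 2) ^ j / fact j * (hop_op m ^^ j) (packed m) y)"
  have h: "?h \<longlonglongrightarrow> ?lim"
    using T by (intro tendsto_intros hop_euler_tendsto) auto
  have "(\<lambda>K. ?h K + ?e K) \<longlonglongrightarrow> ?lim + 0"
    using T by (intro tendsto_add h local_error_tendsto) auto
  then have upper: "(\<lambda>K. ?h K + ?e K) \<longlonglongrightarrow> ?lim"
    by (simp only: add_0_right)
  have "p \<longlonglongrightarrow> ?lim"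
    by (rule tendsto_sandwich[OF _ _ h upper]) (use sandwich in \<open>auto intro!: eventually_sequentiallyI[of 1]\<close>)
  then have "(p \<circ> (\<lambda>r. 2 ^ r)) \<longlonglongrightarrow> ?lim"
    by (rule LIMSEQ_subseq_LIMSEQ) (auto intro: strict_monoI)
  moreover have "(\<lambda>r. prob (grid_event m X (T / 2 ^ r) (2 ^ r) y)) \<longlonglongrightarrow> nonintersecting_prob m X y T"
    unfolding nonintersecting_prob_def nonintersecting_event_eq_INT_grid_events[OF X T y]
    using T by (intro finite_Lim_measure_decseq decseq_grid_events)
      (auto intro!: grid_event_measurable[OF X _ m])
  ultimately show ?thesis
    by (auto simp: p_def comp_def intro: LIMSEQ_unique)
qed

end

section \<open>Asymptotics\<close>

text \<open>With \<open>N = Suc k\<close>, the Lagrange remainder is split as \<open>exp t\<close>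
  times \<open>z\<^sup>2 / (N * (N + 1))\<close> times \<open>z ^ k / fact k\<close>. The last
  factor is a term of the series of \<open>exp z\<close>, so the middle one gives the decay,
  uniformly for \<open>z \<le> Z\<close>.\<close>

lemma exp_taylor_tail_le:
  fixes z Z :: real
  assumes z: "0 \<le> z" "z \<le> Z" and N: "N \<ge> 1"
  shows "exp z - (\<Sum>k\<le>N. z ^ k / fact k) \<le> Z\<^sup>2 * exp (2 * Z) / (real N)\<^sup>2"
proof -
  obtain t where t: "\<bar>t\<bar> \<le> \<bar>z\<bar>" "exp z = (\<Sum>k<Suc N. z ^ k / fact k) + exp t / fact (Suc N) * z ^ Suc N"
    using Maclaurin_exp_le[of z "Suc N"] by blast
  obtain k where k: "N = Suc k" using N by (cases N) auto
  have "z ^ k / fact k \<le> exp z"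
  proof -
    have "(\<Sum>i\<in>{k}. z ^ i /\<^sub>R fact i) \<le> (\<Sum>i. z ^ i /\<^sub>R fact i)"
      using z by (intro sum_le_suminf summable_exp_generic) auto
    then show ?thesis by (simp add: exp_def divide_inverse mult.commute)
  qed
  have "exp z - (\<Sum>k\<le>N. z ^ k / fact k) = exp t / fact (Suc N) * z ^ Suc N"
    using t(2) by (simp add: lessThan_Suc_atMost)
  also have "\<dots> = exp t * (z\<^sup>2 / (real N * real (Suc N))) * (z ^ k / fact k)"
    by (simp add: k power2_eq_square field_simps)
  also have "\<dots> \<le> exp Z * (Z\<^sup>2 / (real N)\<^sup>2) * exp Z"
  proof (intro mult_mono)
    show "exp t \<le> exp Z" using t z by simp
    show "z\<^sup>2 / (real N * real (Suc N)) \<le> Z\<^sup>2 / (real N)\<^sup>2"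
      using z N by (intro frac_le power_mono) (auto simp: power2_eq_square)
    show "z ^ k / fact k \<le> exp Z"
      using \<open>z ^ k / fact k \<le> exp z\<close> z by (meson exp_le_cancel_iff order_trans)
  qed (use z in auto)
  also have "\<dots> = Z\<^sup>2 * exp (2 * Z) / (real N)\<^sup>2"
    by (simp add: exp_double power2_eq_square)
  finally show ?thesis .
qed

text \<open>\<open>Q\<close> is the leading term: the factorial \<open>fact (a + b)\<close> of the
  tableau count cancels against the coefficient of \<open>s ^ (a + b)\<close>.\<close>

lemma two_row_probability_bounds:
  fixes n a b :: nat and w :: "nat \<Rightarrow> int" and s :: real
  assumes n: "n \<ge> 1" and ab: "a \<le> b" "a + b \<le> n + 2" and s: "s \<ge> 0"
    and w: "\<And>k. k \<in> {1..n} \<Longrightarrow> w k = int k" "w (n + 1) = int (n + 1 + a)" "w (n + 2) = int (n + 2 + b)"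
  defines "A \<equiv> (\<Sum>j. s ^ j / fact j * (hop_op (n + 2) ^^ j) (packed (n + 2)) w)"
    and "Q \<equiv> s ^ (a + b) * (real b - real a + 1) / (fact a * fact (b + 1))"
  shows "A \<le> Q * exp (s\<^sup>2)" "A \<ge> Q * (\<Sum>k\<le>n + 2 - (a + b). (s\<^sup>2) ^ k / fact k)"
proof -
  have chamber: "w \<in> chamber (n + 2)"
    by (rule two_rows_in_chamber[OF ab(1) w])
  have disp: "displacement (n + 2) w = int (a + b)"
    using w by (simp add: sum.atLeast_Suc_atMost)
  have "ups (n + 2) (a + b) w = fact (a + b) * (real b - real a + 1) / (fact a * fact (b + 1))"
    by (rule ups_two_rows[OF n ab(1) w])
  then have Q: "s ^ (a + b) / fact (a + b) * ups (n + 2) (a + b) w = Q"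
    by (simp add: Q_def)
  show "A \<le> Q * exp (s\<^sup>2)" "A \<ge> Q * (\<Sum>k\<le>n + 2 - (a + b). (s\<^sup>2) ^ k / fact k)"
    using hop_series_bounds[OF _ chamber _ disp ab(2) s] w(1)[of 1] n unfolding A_def Q by auto
qed

theorem theorem1p19:
  fixes M :: "nat \<Rightarrow> 'a measure"
    and X :: "nat \<Rightarrow> nat \<Rightarrow> real \<Rightarrow> 'a \<Rightarrow> int"
    and x y :: "nat \<Rightarrow> nat \<Rightarrow> int"
    and T :: "nat \<Rightarrow> real"
    and \<beta>\<^sub>1 \<beta>\<^sub>2 :: "nat \<Rightarrow> int"
  assumes prob: "\<And>n. n \<ge> 1 \<Longrightarrow> prob_space (M n)"
    and walks: "\<And>n. n \<ge> 1 \<Longrightarrow>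
        prob_space.independent_ct_random_walks (M n) (n + 2) (x n) (X n)"
    and x: "\<And>n j. n \<ge> 1 \<Longrightarrow> j \<in> {1..n+2} \<Longrightarrow> x n j = int j"
    and y: "\<And>n k. n \<ge> 1 \<Longrightarrow> k \<in> {1..n} \<Longrightarrow> y n k = int k"
    and y_last: "\<And>n. n \<ge> 1 \<Longrightarrow> int n < y n (n+1) \<and> y n (n+1) < y n (n+2)"
    and T_pos: "\<And>n. n \<ge> 1 \<Longrightarrow> T n > 0"
    and \<beta>\<^sub>1: "\<And>n. \<beta>\<^sub>1 n = y n (n+1) - int n"
    and \<beta>\<^sub>2: "\<And>n. \<beta>\<^sub>2 n = y n (n+2) - int n"
    and bounded: "Bseq T" "Bseq (\<lambda>n. real_of_int (\<beta>\<^sub>1 n))" "Bseq (\<lambda>n. real_of_int (\<beta>\<^sub>2 n))"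
  shows "\<exists>\<epsilon> \<in> O(\<lambda>n. 1 / real n ^ 2). \<forall>n\<ge>1.
      prob_space.nonintersecting_prob (M n) (n + 2) (X n) (y n) (T n) =
        exp (- (real n + 2) * T n) * (T n / 2) powi (\<beta>\<^sub>1 n + \<beta>\<^sub>2 n - 3) * exp ((T n)\<^sup>2 / 4)
          / (fact (nat (\<beta>\<^sub>1 n - 1)) * fact (nat (\<beta>\<^sub>2 n - 1)))
          * real_of_int (\<beta>\<^sub>2 n - \<beta>\<^sub>1 n) * (1 + \<epsilon> n)"
proof -
  define p where "p n = prob_space.nonintersecting_prob (M n) (n + 2) (X n) (y n) (T n)" for n
  define G where "G n = exp (- (real n + 2) * T n) * (T n / 2) powi (\<beta>\<^sub>1 n + \<beta>\<^sub>2 n - 3) * exp ((T n)\<^sup>2 / 4)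
          / (fact (nat (\<beta>\<^sub>1 n - 1)) * fact (nat (\<beta>\<^sub>2 n - 1)))
          * real_of_int (\<beta>\<^sub>2 n - \<beta>\<^sub>1 n)" for n
  \<comment> \<open>With the relative error defined as a quotient, the claimed identity only needs
    \<open>G n > 0\<close>; the work lies in bounding its size.\<close>
  define \<epsilon> where "\<epsilon> n = p n / G n - 1" for n
  define z where "z n = (T n / 2)\<^sup>2" for n
  define l where "l n = nat (\<beta>\<^sub>1 n - 1) + nat (\<beta>\<^sub>2 n - 2)" for n
  have G_pos: "G n > 0" if "n \<ge> 1" for n
    using y_last[OF that] T_pos[OF that] unfolding G_def \<beta>\<^sub>1 \<beta>\<^sub>2 by simp
  have \<epsilon>_bound: "\<bar>\<epsilon> n\<bar> \<le> exp (z n) - (\<Sum>k\<le>n + 2 - l n. z n ^ k / fact k)"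
    if n: "n \<ge> 1" and ln: "l n \<le> n + 2" for n
  proof -
    interpret prob_space "M n" using n by (rule prob)
    \<comment> \<open>The displacements of the two top walkers from their starting places
      \<open>n + 1\<close> and \<open>n + 2\<close>.\<close>
    define a b where "a = nat (\<beta>\<^sub>1 n - 1)" and "b = nat (\<beta>\<^sub>2 n - 2)"
    have a: "\<beta>\<^sub>1 n = int a + 1" and b: "\<beta>\<^sub>2 n = int b + 2" and ab: "a \<le> b"
      using y_last[OF n] by (auto simp: a_def b_def \<beta>\<^sub>1 \<beta>\<^sub>2)
    have y_end: "y n (n + 1) = int (n + 1 + a)" "y n (n + 2) = int (n + 2 + b)"
      using a b by (simp_all add: \<beta>\<^sub>1 \<beta>\<^sub>2)
    have l: "l n = a + b" by (simp add: l_def a_def b_def)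
    define s where "s = T n / 2"
    have s: "s > 0" using T_pos[OF n] by (simp add: s_def)
    define A where "A = (\<Sum>j. s ^ j / fact j * (hop_op (n + 2) ^^ j) (packed (n + 2)) (y n))"
    define Q where "Q = s ^ (a + b) * (real b - real a + 1) / (fact a * fact (b + 1))"
    have Q: "Q > 0" using s ab by (simp add: Q_def)
    have A: "A \<le> Q * exp (s\<^sup>2)" "A \<ge> Q * (\<Sum>k\<le>n + 2 - (a + b). (s\<^sup>2) ^ k / fact k)"
      using two_row_probability_bounds[where w = "y n", OF n ab _ _ y[OF n] y_end] ln l s
      unfolding A_def Q_def by auto
    have inj: "inj_on (y n) {1..n + 2}"
    proof (rule inj_onI)
      have cases: "(k \<in> {1..n} \<and> y n k = int k) \<or> k = n + 1 \<or> k = n + 2" if "k \<in> {1..n + 2}" for k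
        using that y[OF n, of k] by auto
      fix i j assume "i \<in> {1..n + 2}" "j \<in> {1..n + 2}" "y n i = y n j"
      with cases[of i] cases[of j] y_last[OF n] show "i = j" by auto
    qed
    have "p n = exp (- (real (n + 2) * T n)) * A"
      unfolding p_def A_def s_def
      using nonintersecting_prob_eq_hop_series[OF walks[OF n] _ T_pos[OF n] x[OF n] inj] by simp
    moreover have "G n = exp (- (real (n + 2) * T n)) * (Q * exp (s\<^sup>2))"
    proof -
      have "\<beta>\<^sub>1 n + \<beta>\<^sub>2 n - 3 = int (a + b)" "nat (\<beta>\<^sub>1 n - 1) = a" "nat (\<beta>\<^sub>2 n - 1) = b + 1"
        "real_of_int (\<beta>\<^sub>2 n - \<beta>\<^sub>1 n) = real b - real a + 1"
        using a b by auto
      moreover have "(T n)\<^sup>2 / 4 = s\<^sup>2" by (simp add: s_def power_divide)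
      ultimately show ?thesis
        unfolding G_def Q_def by (simp only: power_int_of_nat) (simp add: s_def algebra_simps)
    qed
    ultimately have \<epsilon>: "\<epsilon> n = A / (Q * exp (s\<^sup>2)) - 1"
      by (simp add: \<epsilon>_def)
    have z: "z n = s\<^sup>2" by (simp add: z_def s_def)
    let ?S = "\<Sum>k\<le>n + 2 - (a + b). (s\<^sup>2) ^ k / fact k"
    have "\<bar>\<epsilon> n\<bar> = 1 - A / (Q * exp (s\<^sup>2))"
      using A(1) Q by (simp add: \<epsilon> divide_le_eq)
    also have "\<dots> \<le> 1 - ?S / exp (s\<^sup>2)"
      using A(2) Q by (simp add: field_simps)
    also have "\<dots> = (exp (s\<^sup>2) - ?S) / exp (s\<^sup>2)"
      by (simp add: diff_divide_distrib)
    \<comment> \<open>The denominator is at least 1, and the numerator is nonnegative because the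
      chain so far bounds an absolute value by the quotient.\<close>
    also have "\<dots> \<le> exp (s\<^sup>2) - ?S"
    proof -
      have "\<bar>\<epsilon> n\<bar> \<ge> 0" by simp
      with calculation have "(exp (s\<^sup>2) - ?S) / exp (s\<^sup>2) \<ge> 0"
        by linarith
      then have "exp (s\<^sup>2) - ?S \<ge> 0" by (simp add: zero_le_divide_iff)
      then show ?thesis
        by (simp add: divide_le_eq mult_le_cancel_left1)
    qed
    finally show ?thesis by (simp add: z l)
  qed
  obtain Z where Z: "\<And>n. z n \<le> Z"
  proof -
    obtain C where "\<And>n. \<bar>T n\<bar> \<le> C"
      using bounded(1) by (auto simp: Bseq_def)
    then have "(T n)\<^sup>2 \<le> C\<^sup>2" for n
      using power_mono[of "\<bar>T n\<bar>" C 2] by simp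
    then have "z n \<le> C\<^sup>2 / 4" for n
      by (simp add: z_def power_divide)
    then show thesis by (rule that)
  qed
  obtain L where L: "\<And>n. l n \<le> L"
  proof -
    obtain C1 C2 where C: "\<And>n. \<bar>real_of_int (\<beta>\<^sub>1 n)\<bar> \<le> C1" "\<And>n. \<bar>real_of_int (\<beta>\<^sub>2 n)\<bar> \<le> C2"
      using bounded(2,3) by (auto simp: Bseq_def)
    have "l n \<le> nat \<lceil>C1\<rceil> + nat \<lceil>C2\<rceil>" for n
    proof -
      have "\<beta>\<^sub>1 n \<le> \<lceil>C1\<rceil>" "\<beta>\<^sub>2 n \<le> \<lceil>C2\<rceil>"
        using C(1)[of n] C(2)[of n] by linarith+
      then show ?thesis by (simp add: l_def)
    qed
    then show thesis by (rule that)
  qed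
  have "eventually (\<lambda>n. norm (\<epsilon> n) \<le> 4 * Z\<^sup>2 * exp (2 * Z) * norm (1 / real n ^ 2)) sequentially"
  \<comment> \<open>Beyond this threshold the truncation index \<open>N = n + 2 - l n\<close> is at
    least \<open>n / 2\<close>, so replacing \<open>N\<close> by \<open>n\<close> in the tail bound
    costs a factor 4.\<close>
  proof (rule eventually_sequentiallyI[of "2 * L + 1"])
    fix n assume n: "2 * L + 1 \<le> n"
    define N where "N = n + 2 - l n"
    have N: "2 * N \<ge> n" "N \<ge> 1" "l n \<le> n + 2"
      using n L[of n] by (simp_all add: N_def)
    have "\<bar>\<epsilon> n\<bar> \<le> exp (z n) - (\<Sum>k\<le>N. z n ^ k / fact k)"
      using \<epsilon>_bound[of n] n N by (simp add: N_def)
    also have "\<dots> \<le> Z\<^sup>2 * exp (2 * Z) / (real N)\<^sup>2"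
      by (rule exp_taylor_tail_le) (use Z N in \<open>auto simp: z_def\<close>)
    also have "\<dots> \<le> Z\<^sup>2 * exp (2 * Z) / (real n / 2)\<^sup>2"
      using N n by (intro divide_left_mono power_mono mult_pos_pos) auto
    finally show "norm (\<epsilon> n) \<le> 4 * Z\<^sup>2 * exp (2 * Z) * norm (1 / real n ^ 2)"
      by (simp add: power_divide mult_ac)
  qed
  then have "\<epsilon> \<in> O(\<lambda>n. 1 / real n ^ 2)"
    by (rule bigoI)
  moreover have "p n = G n * (1 + \<epsilon> n)" if "n \<ge> 1" for n
    using G_pos[OF that] by (simp add: \<epsilon>_def)
  ultimately show ?thesis
    unfolding p_def G_def by blast
qed

end
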